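(* Let $\Bbbk$ be a field of characteristic $0$ and let $A=\Bbbk_{\mathbf p}[x_1,x_2,x_3]$ be a PI skew polynomial ring. Then $A$ is cancellative in the class of connected graded algebras: if $B$ is a connected graded $\Bbbk$-algebra (not necessarily generated in degree one) and $A[t]\cong B[t]$ as algebras, then $A\cong B$.
   Context: For $\mathbf p=(p_{ij})$ with $p_{ii}=1$, $p_{ij}p_{ji}=1$, $\Bbbk_{\mathbf p}[x_1,x_2,x_3]=\Bbbk\langle x_1,x_2,x_3\rangle/(x_jx_i-p_{ij}x_ix_j)$; it is PI iff every $p_{ij}$ is a root of unity. $A[t]$ denotes the polynomial extension by a central indeterminate $t$. *)

theory Defs
  imports "HOL-Algebra.Algebra"
begin

text \<open>Unital k-algebras are rings (HOL-Algebra) together with a structure map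
  eta : k -> R which is a unital ring homomorphism into the centre of R.
  The scalar action is c . x = eta c * x.\<close>

definition k_algebra :: "('b, 'm) ring_scheme \<Rightarrow> ('k::field \<Rightarrow> 'b) \<Rightarrow> bool" where
  "k_algebra R eta \<longleftrightarrow> ring R \<and> (\<forall>c. eta c \<in> carrier R) \<and> eta 1 = \<one>\<^bsub>R\<^esub> \<and>
     (\<forall>a b. eta (a + b) = eta a \<oplus>\<^bsub>R\<^esub> eta b) \<and> (\<forall>a b. eta (a * b) = eta a \<otimes>\<^bsub>R\<^esub> eta b) \<and>
     (\<forall>c. \<forall>x\<in>carrier R. eta c \<otimes>\<^bsub>R\<^esub> x = x \<otimes>\<^bsub>R\<^esub> eta c)"

definition alg_iso :: "('a, 'm) ring_scheme \<Rightarrow> ('k \<Rightarrow> 'a) \<Rightarrow> ('b, 'n) ring_scheme \<Rightarrow> ('k \<Rightarrow> 'b)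
    \<Rightarrow> ('a \<Rightarrow> 'b) \<Rightarrow> bool" where
  "alg_iso R etaR S etaS phi \<longleftrightarrow> phi \<in> ring_iso R S \<and> (\<forall>c. phi (etaR c) = etaS c)"

definition conn_graded :: "('b, 'm) ring_scheme \<Rightarrow> ('k::field \<Rightarrow> 'b) \<Rightarrow> (nat \<Rightarrow> 'b set) \<Rightarrow> bool" where
  "conn_graded R eta G \<longleftrightarrow>
     (\<forall>n. G n \<subseteq> carrier R \<and> \<zero>\<^bsub>R\<^esub> \<in> G n \<and> (\<forall>x\<in>G n. \<forall>y\<in>G n. x \<oplus>\<^bsub>R\<^esub> y \<in> G n) \<and>
          (\<forall>c. \<forall>x\<in>G n. eta c \<otimes>\<^bsub>R\<^esub> x \<in> G n)) \<and>
     (\<forall>m n. \<forall>x\<in>G m. \<forall>y\<in>G n. x \<otimes>\<^bsub>R\<^esub> y \<in> G (m + n)) \<and>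
     G 0 = range eta \<and>
     (\<forall>b\<in>carrier R. \<exists>!f. (\<forall>n. f n \<in> G n) \<and> finite {n. f n \<noteq> \<zero>\<^bsub>R\<^esub>} \<and>
                          b = finsum R f {n. f n \<noteq> \<zero>\<^bsub>R\<^esub>})"

text \<open>Polynomial extension R[t] is UP R (t central); its structure map.\<close>

definition poly_unit :: "('b, 'm) ring_scheme \<Rightarrow> ('k \<Rightarrow> 'b) \<Rightarrow> 'k \<Rightarrow> nat \<Rightarrow> 'b" where
  "poly_unit R eta c = (\<lambda>n. if n = 0 then eta c else \<zero>\<^bsub>R\<^esub>)"

text \<open>The skew polynomial ring k_p[x1,x2,x3], modelled on its PBW basis of ordered
  monomials x1^a1 x2^a2 x3^a3 (exponent triples), with
  x^a x^b = p12^(a2 b1) p13^(a3 b1) p23^(a3 b2) x^(a+b),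
  which is what the relations x_j x_i = p_ij x_i x_j give.\<close>

definition skew_tw :: "(nat \<Rightarrow> nat \<Rightarrow> 'k::field) \<Rightarrow> nat \<times> nat \<times> nat \<Rightarrow> nat \<times> nat \<times> nat \<Rightarrow> 'k" where
  "skew_tw p a b = (case a of (a1, a2, a3) \<Rightarrow> case b of (b1, b2, b3) \<Rightarrow>
      p 1 2 ^ (a2 * b1) * p 1 3 ^ (a3 * b1) * p 2 3 ^ (a3 * b2))"

definition skew_mult :: "(nat \<Rightarrow> nat \<Rightarrow> 'k::field) \<Rightarrow> (nat \<times> nat \<times> nat \<Rightarrow> 'k)
    \<Rightarrow> (nat \<times> nat \<times> nat \<Rightarrow> 'k) \<Rightarrow> nat \<times> nat \<times> nat \<Rightarrow> 'k" where
  "skew_mult p f g m = (case m of (m1, m2, m3) \<Rightarrow>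
     (\<Sum>a1\<le>m1. \<Sum>a2\<le>m2. \<Sum>a3\<le>m3.
        f (a1, a2, a3) * g (m1 - a1, m2 - a2, m3 - a3) *
        skew_tw p (a1, a2, a3) (m1 - a1, m2 - a2, m3 - a3)))"

definition skew_poly :: "(nat \<Rightarrow> nat \<Rightarrow> 'k::field) \<Rightarrow> (nat \<times> nat \<times> nat \<Rightarrow> 'k) ring" where
  "skew_poly p = \<lparr> carrier = {f. finite {m. f m \<noteq> 0}},
                   monoid.mult = skew_mult p,
                   monoid.one = (\<lambda>m. if m = (0, 0, 0) then 1 else 0),
                   ring.zero = (\<lambda>m. 0),
                   ring.add = (\<lambda>f g m. f m + g m) \<rparr>"

definition skew_unit :: "(nat \<Rightarrow> nat \<Rightarrow> 'k::field) \<Rightarrow> 'k \<Rightarrow> nat \<times> nat \<times> nat \<Rightarrow> 'k" where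
  "skew_unit p c = (\<lambda>m. if m = (0, 0, 0) then c else 0)"

end

theory Submission
  imports Defs "HOL-Library.Function_Algebras" "HOL-Library.Product_Plus" "HOL-Library.Product_Lexorder"
begin

text \<open>Let \<open>y\<^sub>1, y\<^sub>2, y\<^sub>3, t'\<close> be the images in \<open>B[t]\<close> of the generators of \<open>A[t]\<close>. They are normal
  elements of a domain, so comparing degrees shows that conjugation by each of them is an automorphism
  preserving the grading of \<open>B\<close> and the degree in \<open>t\<close>. Hence all bihomogeneous components of the
  \<open>y\<^sub>i\<close> still satisfy the skew commutation relations. With \<open>M\<close> the augmentation ideal of \<open>B[t]\<close>, a
  Steinitz exchange modulo \<open>k + M\<^sup>2\<close> replaces each \<open>y\<^sub>i\<close> by one of its components; one of these
  is a multiple of \<open>t\<close>, and its index is central and can be swapped with that of \<open>t'\<close>. The other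
  three give homogeneous generators of \<open>B\<close> with the relations of \<open>A\<close>, that is, a surjection
  \<open>A \<rightarrow> B\<close>. It is injective because the surjection \<open>A[t] \<rightarrow> B[t] \<cong> A[t]\<close> it induces
  respects (after a translation of central variables) the powers of the augmentation ideal, whose
  quotients are finite-dimensional.\<close>

section \<open>Algebras with scalars and linear spans\<close>

text \<open>The obstacle is that \<open>A[t] \<cong> B[t]\<close> need not respect any grading: the
  image of a generator may have many bihomogeneous components, scalars and multiples of
  \<open>t\<close> among them. Normality turns a relation \<open>y z = q z y\<close> into the same
  relation, with the same \<open>q\<close>, between every component of \<open>y\<close> and every
  component of \<open>z\<close>. Components of different generators can therefore be chosen
  independently of each other, as long as it is remembered from which generator each one comes.

  If a component of a generator has a nonzero scalar coefficient, cancellation gives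
  \<open>q = 1\<close> in every relation of that generator. This observation is used twice: it frees
  the index that is exchanged with that of \<open>t'\<close>, and it makes the translation into the
  augmentation ideal compatible with the relations, because a nonzero constant is subtracted only
  where \<open>q = 1\<close>.

  The concluding dimension count compares two systems of monomials indexed by the same exponents.
  Modulo a high power of the augmentation ideal only finitely many exponents remain, and there a
  spanning system of the right size is a basis.\<close>

locale kalg = ring R for R (structure) +
  fixes eta :: "'k::field \<Rightarrow> 'a"
  assumes eta_closed [simp, intro]: "eta c \<in> carrier R"
    and eta_1 [simp]: "eta 1 = \<one>"
    and eta_add: "eta (a + b) = eta a \<oplus> eta b"
    and eta_mult: "eta (a * b) = eta a \<otimes> eta b"
    and eta_central: "x \<in> carrier R \<Longrightarrow> eta c \<otimes> x = x \<otimes> eta c"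

lemma kalg_iff: "kalg R eta \<longleftrightarrow> k_algebra R eta"
  unfolding kalg_def kalg_axioms_def k_algebra_def by blast

context kalg
begin

lemma eta_0 [simp]: "eta 0 = \<zero>"
  using eta_add[of 0 0] by (metis add.r_cancel_one' add_0 eta_closed)

definition smul :: "'k \<Rightarrow> 'a \<Rightarrow> 'a" (infixr "\<star>" 75)
  where "c \<star> x = eta c \<otimes> x"

lemma smul_closed [simp, intro]: "x \<in> carrier R \<Longrightarrow> c \<star> x \<in> carrier R"
  by (simp add: smul_def)

lemma smul_smul [simp]: "x \<in> carrier R \<Longrightarrow> c \<star> d \<star> x = (c * d) \<star> x"
  by (simp add: smul_def eta_mult m_assoc)

lemma smul_add: "\<lbrakk>x \<in> carrier R; y \<in> carrier R\<rbrakk> \<Longrightarrow> c \<star> (x \<oplus> y) = c \<star> x \<oplus> c \<star> y"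
  by (simp add: smul_def r_distr)

lemma add_smul: "x \<in> carrier R \<Longrightarrow> (c + d) \<star> x = c \<star> x \<oplus> d \<star> x"
  by (simp add: smul_def eta_add l_distr)

lemma smul_mult_l [simp]: "\<lbrakk>x \<in> carrier R; y \<in> carrier R\<rbrakk> \<Longrightarrow> (c \<star> x) \<otimes> y = c \<star> (x \<otimes> y)"
  by (simp add: smul_def m_assoc)

lemma smul_mult_r [simp]: "\<lbrakk>x \<in> carrier R; y \<in> carrier R\<rbrakk> \<Longrightarrow> x \<otimes> (c \<star> y) = c \<star> (x \<otimes> y)"
  by (metis smul_def eta_central eta_closed m_assoc)

lemma smul_1 [simp]: "x \<in> carrier R \<Longrightarrow> 1 \<star> x = x"
  by (simp add: smul_def)

lemma smul_0 [simp]: "x \<in> carrier R \<Longrightarrow> 0 \<star> x = \<zero>"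
  by (simp add: smul_def)

lemma smul_zero [simp]: "c \<star> \<zero> = \<zero>"
  by (simp add: smul_def)

lemma smul_one: "c \<star> \<one> = eta c"
  by (simp add: smul_def)

lemma smul_minus1: "x \<in> carrier R \<Longrightarrow> (-1) \<star> x = \<ominus> x"
  using add_smul[of x 1 "-1"] by (metis add.right_inverse minus_equality smul_0 smul_1 smul_closed a_comm)

lemma smul_eq_zero: "\<lbrakk>x \<in> carrier R; c \<star> x = \<zero>; c \<noteq> 0\<rbrakk> \<Longrightarrow> x = \<zero>"
  by (metis left_inverse smul_1 smul_smul smul_zero)

text \<open>Membership of \<open>s\<close> in the carrier is part of the rule, so
  \<open>lspan S\<close> is a subspace of the carrier for every set \<open>S\<close>, and induction
  peels off one generator at a time.\<close>

inductive_set lspan :: "'a set \<Rightarrow> 'a set" for S where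
  lspan_zero [simp, intro]: "\<zero> \<in> lspan S"
| lspan_step: "\<lbrakk>x \<in> lspan S; s \<in> S; s \<in> carrier R\<rbrakk> \<Longrightarrow> c \<star> s \<oplus> x \<in> lspan S"

lemma lspan_carrier: "x \<in> lspan S \<Longrightarrow> x \<in> carrier R"
  by (induction rule: lspan.induct) auto

lemma lspan_base: "\<lbrakk>s \<in> S; s \<in> carrier R\<rbrakk> \<Longrightarrow> s \<in> lspan S"
  using lspan_step[OF lspan_zero, of s S 1] by simp

lemma lspan_add: "\<lbrakk>x \<in> lspan S; y \<in> lspan S\<rbrakk> \<Longrightarrow> x \<oplus> y \<in> lspan S"
proof (induction rule: lspan.induct)
  case lspan_zero
  then show ?case using lspan_carrier by simp
next
  case (lspan_step x s c)
  then show ?case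
    using lspan.lspan_step[of "x \<oplus> y" S s c] by (simp add: lspan_carrier a_assoc)
qed

lemma lspan_smul: "x \<in> lspan S \<Longrightarrow> c \<star> x \<in> lspan S"
proof (induction rule: lspan.induct)
  case lspan_zero
  then show ?case by simp
next
  case (lspan_step x s d)
  then show ?case
    using lspan.lspan_step[of "c \<star> x" S s "c * d"] by (simp add: lspan_carrier smul_add)
qed

lemma lspan_minus: "\<lbrakk>x \<in> lspan S; y \<in> lspan S\<rbrakk> \<Longrightarrow> x \<ominus> y \<in> lspan S"
  using lspan_add[of x S "(-1) \<star> y"] lspan_smul[of y S "-1"] lspan_carrier
  by (simp add: smul_minus1 a_minus_def)

lemma lspan_sub: 
  assumes "x \<in> lspan S" "\<And>s. s \<in> S \<Longrightarrow> s \<in> carrier R \<Longrightarrow> s \<in> lspan T"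
  shows "x \<in> lspan T"
  using assms(1)
proof (induction rule: lspan.induct)
  case (lspan_step x s c)
  then show ?case by (simp add: lspan_add lspan_smul assms(2))
qed simp

lemma lspan_mono: "S \<subseteq> T \<Longrightarrow> lspan S \<subseteq> lspan T"
  by (meson lspan_base lspan_sub subset_iff)

lemma lspan_mult:
  assumes "x \<in> lspan S" "y \<in> lspan T"
    and st: "\<And>s t. \<lbrakk>s \<in> S; t \<in> T; s \<in> carrier R; t \<in> carrier R\<rbrakk> \<Longrightarrow> s \<otimes> t \<in> lspan U"
  shows "x \<otimes> y \<in> lspan U"
proof -
  have *: "s \<otimes> y \<in> lspan U" if "s \<in> S" "s \<in> carrier R" for s
    using assms(2)
  proof (induction rule: lspan.induct)
    case lspan_zero
    then show ?case using that by simp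
  next
    case (lspan_step y t c)
    then show ?case
      using that st[of s t] by (simp add: r_distr lspan_carrier lspan_add lspan_smul)
  qed
  show ?thesis using assms(1)
  proof (induction rule: lspan.induct)
    case lspan_zero
    then show ?case using assms(2) by (simp add: lspan_carrier)
  next
    case (lspan_step x s c)
    then show ?case
      using *[of s] assms(2) by (simp add: l_distr lspan_carrier lspan_add lspan_smul)
  qed
qed

lemma lspan_insertD:
  assumes "x \<in> lspan (insert u T)" "u \<in> carrier R"
  obtains c s where "s \<in> lspan T" "x = c \<star> u \<oplus> s"
proof -
  from assms(1) have "\<exists>c s. s \<in> lspan T \<and> x = c \<star> u \<oplus> s"
  proof (induction rule: lspan.induct)
    case lspan_zero
    then show ?case using assms(2) by (intro exI[of _ 0] exI[of _ \<zero>]) simp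
  next
    case (lspan_step x s c)
    then obtain d r where dr: "r \<in> lspan T" "x = d \<star> u \<oplus> r" by blast
    note [simp] = lspan_carrier[OF dr(1)] assms(2) lspan_step(3)
    show ?case
    proof (cases "s = u")
      case True
      then show ?thesis
        by (intro exI[of _ "c + d"] exI[of _ r]) (simp add: dr add_smul a_assoc)
    next
      case False
      then have "s \<in> T" using lspan_step by simp
      then show ?thesis
        by (intro exI[of _ d] exI[of _ "c \<star> s \<oplus> r"])
          (simp add: dr lspan.lspan_step a_lcomm)
    qed
  qed
  then show ?thesis using that by blast
qed

text \<open>Steinitz step with a set \<open>C\<close> of candidates. If all of them lie in
  \<open>lspan T\<close>, then \<open>u\<close> is redundant and any candidate will do; otherwise a
  candidate outside \<open>lspan T\<close> has a nonzero \<open>u\<close>-coefficient and can be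
  solved for \<open>u\<close>. Only spanning is carried along; independence is recovered much later
  by counting dimensions.\<close>

lemma lspan_exchange:
  assumes full: "carrier R = lspan (insert u T)" and u: "u \<in> lspan C" and C: "C \<noteq> {}"
    and CR: "C \<subseteq> carrier R"
  shows "\<exists>c\<in>C. carrier R = lspan (insert c T)"
proof (cases "C \<subseteq> lspan T")
  case True
  then have uT: "u \<in> lspan T" using lspan_sub[OF u] by blast
  obtain c where c: "c \<in> C" using C by blast
  have "x \<in> lspan (insert c T)" if "x \<in> carrier R" for x
    using that unfolding full
    by (rule lspan_sub) (metis insertE uT lspan_base lspan_mono subset_insertI subsetD insertI2)
  then show ?thesis using c lspan_carrier by blast
next
  case False
  then obtain c where c: "c \<in> C" "c \<notin> lspan T" by blast
  have uR: "u \<in> carrier R" using u lspan_carrier by blast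
  have cR: "c \<in> carrier R" using c CR by blast
  obtain a s where s: "s \<in> lspan T" "c = a \<star> u \<oplus> s"
    using lspan_insertD[OF _ uR] cR full by metis
  note sR = lspan_carrier[OF s(1)]
  have "a \<noteq> 0" using c s uR sR by auto
  have "c \<ominus> s = a \<star> u" using s sR uR
    by (simp add: a_minus_def a_assoc r_neg)
  then have "inverse a \<star> (c \<ominus> s) = u" using \<open>a \<noteq> 0\<close> uR by simp
  moreover have "inverse a \<star> (c \<ominus> s) \<in> lspan (insert c T)"
    using s(1) cR by (meson lspan_base lspan_minus lspan_mono lspan_smul subset_insertI subsetD insertI1)
  ultimately have uT: "u \<in> lspan (insert c T)" by simp
  have "x \<in> lspan (insert c T)" if "x \<in> carrier R" for x
    using that unfolding full
    by (rule lspan_sub) (metis insertE uT lspan_base insertI2)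
  then show ?thesis using c lspan_carrier by blast
qed

lemma lspan_finsum: "\<lbrakk>finite I; \<And>i. i \<in> I \<Longrightarrow> f i \<in> lspan S\<rbrakk> \<Longrightarrow> finsum R f I \<in> lspan S"
proof (induction rule: finite_induct)
  case (insert i I)
  then have "finsum R f (insert i I) = f i \<oplus> finsum R f I"
    by (intro finsum_insert) (auto intro: lspan_carrier)
  then show ?case using insert by (simp add: lspan_add)
qed simp

end

section \<open>Linear combinations, independence and coordinates\<close>

lemma sum_fun_apply: "(\<Sum>x\<in>A. f x) i = (\<Sum>x\<in>A. f x i)" for f :: "'i \<Rightarrow> 'j \<Rightarrow> 'k::comm_monoid_add"
  by (induction A rule: infinite_finite_induct) (auto simp: zero_fun_def plus_fun_def)

lemma finite_supp_add:
  "\<lbrakk>finite {x. f x \<noteq> 0}; finite {x. g x \<noteq> 0}\<rbrakk> \<Longrightarrow> finite {x. (f x + g x :: 'k::comm_monoid_add) \<noteq> 0}"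
  by (rule finite_subset[of _ "{x. f x \<noteq> 0} \<union> {x. g x \<noteq> 0}"]) auto

context kalg
begin

definition lcomb :: "('i \<Rightarrow> 'a) \<Rightarrow> ('i \<Rightarrow> 'k) \<Rightarrow> 'a"
  where "lcomb e d = (\<Oplus>x\<in>{x. d x \<noteq> 0}. d x \<star> e x)"

text \<open>Independence of a family, not of a set: a repeated member counts as a dependence, and
  the indices can serve as exponents of monomials.\<close>

definition indep :: "('i \<Rightarrow> 'a) \<Rightarrow> bool"
  where "indep e \<longleftrightarrow> (\<forall>d. finite {x. d x \<noteq> 0} \<longrightarrow> lcomb e d = \<zero> \<longrightarrow> (\<forall>x. d x = 0))"

lemma indepD: "\<lbrakk>indep e; finite {x. d x \<noteq> 0}; lcomb e d = \<zero>\<rbrakk> \<Longrightarrow> d x = 0"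
  unfolding indep_def by (drule spec[of _ d]) iprover

lemma lcomb_superset:
  assumes "range e \<subseteq> carrier R" "finite J" "{x. d x \<noteq> 0} \<subseteq> J"
  shows "lcomb e d = (\<Oplus>x\<in>J. d x \<star> e x)"
proof -
  have "e x \<in> carrier R" for x using assms(1) by auto
  then show ?thesis
    unfolding lcomb_def by (intro add.finprod_mono_neutral_cong_left) (use assms in auto)
qed

lemma lcomb_closed: "range e \<subseteq> carrier R \<Longrightarrow> lcomb e d \<in> carrier R"
  unfolding lcomb_def by (intro finsum_closed) auto

lemma lcomb_add:
  assumes e: "range e \<subseteq> carrier R" and d: "finite {x. d x \<noteq> 0}" "finite {x. d' x \<noteq> 0}"
  shows "lcomb e (\<lambda>x. d x + d' x) = lcomb e d \<oplus> lcomb e d'"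
proof -
  let ?J = "{x. d x \<noteq> 0} \<union> {x. d' x \<noteq> 0}"
  have eR: "e x \<in> carrier R" for x using e by auto
  have "lcomb e (\<lambda>x. d x + d' x) = (\<Oplus>x\<in>?J. (d x + d' x) \<star> e x)"
    by (rule lcomb_superset) (use e d in auto)
  also have "\<dots> = (\<Oplus>x\<in>?J. d x \<star> e x \<oplus> d' x \<star> e x)"
    using eR by (simp add: add_smul)
  also have "\<dots> = (\<Oplus>x\<in>?J. d x \<star> e x) \<oplus> (\<Oplus>x\<in>?J. d' x \<star> e x)"
    by (rule finsum_addf) (use eR in auto)
  also have "(\<Oplus>x\<in>?J. d x \<star> e x) = lcomb e d"
    by (rule lcomb_superset[symmetric]) (use e d in auto)
  also have "(\<Oplus>x\<in>?J. d' x \<star> e x) = lcomb e d'"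
    by (rule lcomb_superset[symmetric]) (use e d in auto)
  finally show ?thesis .
qed

lemma lcomb_single: "range e \<subseteq> carrier R \<Longrightarrow> lcomb e (\<lambda>x. if x = m then c else 0) = c \<star> e m"
proof -
  assume e: "range e \<subseteq> carrier R"
  then have "lcomb e (\<lambda>x. if x = m then c else 0) = (\<Oplus>x\<in>{m}. (if x = m then c else 0) \<star> e x)"
    by (intro lcomb_superset) auto
  also have "\<dots> = c \<star> e m"
    using e finsum_insert[of "{}" m "\<lambda>x. (if x = m then c else 0) \<star> e x"]
    by (simp add: image_subset_iff)
  finally show ?thesis .
qed

lemma lcomb_smul:
  assumes e: "range e \<subseteq> carrier R" and d: "finite {x. d x \<noteq> 0}"
  shows "lcomb e (\<lambda>x. c * d x) = c \<star> lcomb e d"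
proof -
  have eR: "e x \<in> carrier R" for x using e by auto
  have "lcomb e (\<lambda>x. c * d x) = (\<Oplus>x\<in>{x. d x \<noteq> 0}. (c * d x) \<star> e x)"
    by (rule lcomb_superset) (use e d in auto)
  also have "\<dots> = (\<Oplus>x\<in>{x. d x \<noteq> 0}. eta c \<otimes> (d x \<star> e x))"
    using eR by (intro finsum_cong') (auto simp flip: smul_def)
  also have "\<dots> = eta c \<otimes> lcomb e d"
    unfolding lcomb_def by (rule finsum_rdistr[symmetric]) (use d eR in auto)
  finally show ?thesis by (simp add: smul_def)
qed

lemma lcomb_zero: "lcomb e (\<lambda>x. 0) = \<zero>"
  by (simp add: lcomb_def)

lemma lcomb_in_lspan:
  assumes "range e \<subseteq> carrier R" "{x. d x \<noteq> 0} \<subseteq> J" "finite {x. d x \<noteq> 0}"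
  shows "lcomb e d \<in> lspan (e ` J)"
  unfolding lcomb_def
  by (rule lspan_finsum) (use assms in \<open>auto intro!: lspan_smul lspan_base\<close>)

lemma lspan_lcomb:
  assumes "x \<in> lspan (e ` J)" and e: "range e \<subseteq> carrier R"
  obtains d where "finite {x. d x \<noteq> 0}" "{x. d x \<noteq> 0} \<subseteq> J" "x = lcomb e d"
proof -
  from assms(1) have "\<exists>d. finite {x. d x \<noteq> 0} \<and> {x. d x \<noteq> 0} \<subseteq> J \<and> x = lcomb e d"
  proof (induction rule: lspan.induct)
    case lspan_zero
    show ?case by (rule exI[of _ "\<lambda>x. 0"]) (simp add: lcomb_zero)
  next
    case (lspan_step x s c)
    then obtain d i where d: "finite {x. d x \<noteq> 0}" "{x. d x \<noteq> 0} \<subseteq> J" "x = lcomb e d"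
      and i: "i \<in> J" "s = e i" by blast
    let ?s = "\<lambda>x. if x = i then c else 0"
    have fs: "finite {x. ?s x \<noteq> 0}" by (rule finite_subset[of _ "{i}"]) auto
    have "c \<star> s \<oplus> x = lcomb e (\<lambda>x. ?s x + d x)"
      by (subst lcomb_add) (use d e i fs in \<open>auto simp: lcomb_single\<close>)
    moreover have "finite {x. ?s x + d x \<noteq> 0}" using fs d(1) by (rule finite_supp_add)
    moreover have "{x. ?s x + d x \<noteq> 0} \<subseteq> J" using d i by auto
    ultimately show ?case by (intro exI[of _ "\<lambda>x. ?s x + d x"]) simp
  qed
  then show ?thesis using that by blast
qed

text \<open>The choice is unique on the span of an independent family (\<open>coord_unique\<close>)
  and meaningless elsewhere.\<close>

definition coord :: "('i \<Rightarrow> 'a) \<Rightarrow> 'a \<Rightarrow> 'i \<Rightarrow> 'k"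
  where "coord e r = (SOME d. finite {x. d x \<noteq> 0} \<and> r = lcomb e d)"

lemma coord_spec:
  assumes "range e \<subseteq> carrier R" "r \<in> lspan (range e)"
  shows "finite {x. coord e r x \<noteq> 0}" "lcomb e (coord e r) = r"
proof -
  obtain d where "finite {x. d x \<noteq> 0}" "r = lcomb e d"
    using lspan_lcomb[OF assms(2,1)] by blast
  then have "\<exists>d. finite {x. d x \<noteq> 0} \<and> r = lcomb e d" by metis
  then have "finite {x. coord e r x \<noteq> 0} \<and> r = lcomb e (coord e r)"
    unfolding coord_def by (rule someI_ex)
  then show "finite {x. coord e r x \<noteq> 0}" "lcomb e (coord e r) = r" by simp_all
qed

lemma coord_unique:
  assumes e: "range e \<subseteq> carrier R" and ind: "indep e" and d: "finite {x. d x \<noteq> 0}"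
  shows "coord e (lcomb e d) = d"
proof
  fix x
  let ?r = "lcomb e d"
  have r: "?r \<in> lspan (range e)" using lcomb_in_lspan[OF e, of d UNIV] d by simp
  note c = coord_spec[OF e r]
  have fm: "finite {x. (-1) * d x \<noteq> 0}" using d by simp
  have "lcomb e (\<lambda>x. coord e ?r x + (-1) * d x) = ?r \<oplus> (-1) \<star> ?r"
    by (subst lcomb_add) (use e c d fm lcomb_smul[OF e d, of "-1"] in auto)
  also have "\<dots> = \<zero>" using lcomb_closed[OF e] by (simp add: smul_minus1 r_neg)
  finally have "coord e ?r x + (-1) * d x = 0"
    using indepD[OF ind finite_supp_add[OF c(1) fm]] by blast
  then show "coord e ?r x = d x" by simp
qed

context
  fixes e :: "'i \<Rightarrow> 'a"
  assumes e: "range e \<subseteq> carrier R" and ind: "indep e"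
begin

lemma coord_add:
  assumes "r \<in> lspan (range e)" "s \<in> lspan (range e)"
  shows "coord e (r \<oplus> s) = (\<lambda>x. coord e r x + coord e s x)"
proof -
  note r = coord_spec[OF e assms(1)] and s = coord_spec[OF e assms(2)]
  have "lcomb e (\<lambda>x. coord e r x + coord e s x) = r \<oplus> s"
    using lcomb_add[OF e r(1) s(1)] r s by simp
  then show ?thesis using coord_unique[OF e ind finite_supp_add[OF r(1) s(1)]] by simp
qed

lemma coord_smul:
  assumes "r \<in> lspan (range e)"
  shows "coord e (c \<star> r) = (\<lambda>x. c * coord e r x)"
proof -
  note r = coord_spec[OF e assms(1)]
  have "finite {x. c * coord e r x \<noteq> 0}" by (rule finite_subset[OF _ r(1)]) auto
  moreover have "lcomb e (\<lambda>x. c * coord e r x) = c \<star> r"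
    using lcomb_smul[OF e r(1)] r by simp
  ultimately show ?thesis using coord_unique[OF e ind] by metis
qed

lemma coord_zero: "coord e \<zero> = (\<lambda>x. 0)"
  using coord_unique[OF e ind, of "\<lambda>x. 0"] by (simp add: lcomb_zero)

lemma coord_base: "coord e (e i) = (\<lambda>x. if x = i then 1 else 0)"
proof -
  have "finite {x. (if x = i then 1 else 0 :: 'k) \<noteq> 0}" by (rule finite_subset[of _ "{i}"]) auto
  then show ?thesis
    using coord_unique[OF e ind, of "\<lambda>x. if x = i then 1 else 0"] lcomb_single[OF e, of i 1] e 
    by (simp add: image_subset_iff)
qed

lemma coord_finsum:
  assumes "finite J" "\<And>x. x \<in> J \<Longrightarrow> f x \<in> lspan (range e)"
  shows "coord e (\<Oplus>x\<in>J. d x \<star> f x) i = (\<Sum>x\<in>J. d x * coord e (f x) i)"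
  using assms
proof (induction rule: finite_induct)
  case (insert x J)
  then have "(\<Oplus>x\<in>insert x J. d x \<star> f x) = d x \<star> f x \<oplus> (\<Oplus>x\<in>J. d x \<star> f x)"
    by (intro finsum_insert) (auto intro: lspan_carrier)
  moreover have "(\<Oplus>x\<in>J. d x \<star> f x) \<in> lspan (range e)"
    using insert by (intro lspan_finsum) (auto intro: lspan_smul)
  ultimately show ?case using insert by (simp add: coord_add coord_smul lspan_smul)
qed (simp add: coord_zero)

lemma coord_vanish:
  assumes "r \<in> lspan (e ` Y)" "i \<notin> Y"
  shows "coord e r i = 0"
proof -
  obtain d where "finite {x. d x \<noteq> 0}" "{x. d x \<noteq> 0} \<subseteq> Y" "r = lcomb e d"
    using lspan_lcomb[OF assms(1) e] by blast
  then show ?thesis using coord_unique[OF e ind] assms(2) by auto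
qed

end

text \<open>A spanning family of a finite-dimensional quotient is a basis of it if it has as many
  members as a known basis.\<close>

lemma indep_mod:
  fixes e f :: "'i \<Rightarrow> 'a" and d :: "'i \<Rightarrow> 'k"
  assumes e: "range e \<subseteq> carrier R" and ind: "indep e" and full: "lspan (range e) = carrier R"
    and f: "range f \<subseteq> carrier R" and J: "finite J"
    and gen: "\<And>x. x \<in> J \<Longrightarrow> e x \<in> lspan (f ` J \<union> e ` (- J))"
    and d: "{x. d x \<noteq> 0} \<subseteq> J" and dep: "lcomb f d \<in> lspan (e ` (- J))"
  shows "d x = 0"
proof (rule ccontr)
  assume dx: "d x \<noteq> 0"
  interpret V: vector_space "\<lambda>(c::'k) (u :: 'i \<Rightarrow> 'k). (\<lambda>i. c * u i)"
    by unfold_locales (auto simp: algebra_simps fun_eq_iff)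
  \<comment> \<open>Keeping only the coordinates in \<open>J\<close> models the quotient by the span
    of the remaining \<open>e\<close>, inside a function space where the theory \<open>V\<close> of
    vector spaces applies.\<close>
  define P where "P r = (\<lambda>i. if i \<in> J then coord e r i else 0)" for r
  have P_add: "P (r \<oplus> s) = P r + P s" if "r \<in> carrier R" "s \<in> carrier R" for r s
    using that coord_add[OF e ind] full by (auto simp: P_def fun_eq_iff)
  have P_smul: "P (c \<star> r) = (\<lambda>i. c * P r i)" if "r \<in> carrier R" for r c
    using that coord_smul[OF e ind] full by (auto simp: P_def fun_eq_iff)
  have P_0: "P r = 0" if "r \<in> lspan (e ` (- J))" for r
    using coord_vanish[OF e ind that] by (auto simp: P_def fun_eq_iff)
  have P_span: "P r \<in> V.span ((P \<circ> f) ` J)" if "r \<in> lspan (f ` J \<union> e ` (- J))" for r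
    using that
  proof (induction rule: lspan.induct)
    case lspan_zero
    have "P \<zero> = 0" by (rule P_0) simp
    then show ?case by (metis V.span_zero)
  next
    case (lspan_step r s c)
    have "P s \<in> V.span ((P \<circ> f) ` J)"
    proof (cases "s \<in> f ` J")
      case True
      then show ?thesis by (auto intro: V.span_base)
    next
      case False
      then have "P s = 0" using lspan_step by (intro P_0 lspan_base) auto
      then show ?thesis by (metis V.span_zero)
    qed
    then have "P (c \<star> s) \<in> V.span ((P \<circ> f) ` J)" using V.span_scale P_smul lspan_step by metis
    moreover have "P (c \<star> s \<oplus> r) = P (c \<star> s) + P r"
      using lspan_step(1,3) by (intro P_add) (auto intro: lspan_carrier)
    ultimately show ?case using V.span_add lspan_step(4) by metis
  qed
  have xJ: "x \<in> J" using d dx by blast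
  define D where "D i = (\<lambda>x. if x = i then 1 else 0 :: 'k)" for i :: 'i
  have D: "D i \<in> V.span ((P \<circ> f) ` J)" if "i \<in> J" for i
  proof -
    have "D i = P (e i)" using that coord_base[OF e ind] by (auto simp: D_def P_def fun_eq_iff)
    then show ?thesis using P_span[OF gen[OF that]] by simp
  qed
  define h where "h y = (\<lambda>i. d y * P (f y) i)" for y
  have "sum h J = 0"
  proof
    fix i
    have "(\<Sum>y\<in>J. d y * P (f y) i) = P (lcomb f d) i"
      using lcomb_superset[OF f J d] coord_finsum[OF e ind J, of f d i] f full
      by (auto simp: P_def image_subset_iff)
    also have "\<dots> = 0" using P_0[OF dep] by simp
    finally show "sum h J i = 0 i" by (simp add: sum_fun_apply h_def)
  qed
  \<comment> \<open>A nonzero \<open>d x\<close> expresses \<open>P (f x)\<close> through the other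
    \<open>P (f y)\<close>. Then fewer than \<open>card J\<close> vectors span the
    \<open>card J\<close> independent unit vectors \<open>D i\<close>.\<close>
  then have "h x = - sum h (J - {x})"
    by (metis sum.remove[OF J xJ] eq_neg_iff_add_eq_0)
  also have "\<dots> \<in> V.span ((P \<circ> f) ` (J - {x}))"
    unfolding h_def by (intro V.span_neg V.span_sum V.span_scale V.span_base) auto
  finally have "(\<lambda>i. d x * P (f x) i) \<in> V.span ((P \<circ> f) ` (J - {x}))"
    unfolding h_def .
  then have "(\<lambda>i. inverse (d x) * (d x * P (f x) i)) \<in> V.span ((P \<circ> f) ` (J - {x}))"
    by (rule V.span_scale)
  moreover have "(\<lambda>i. inverse (d x) * (d x * P (f x) i)) = P (f x)" using dx by auto
  ultimately have "P (f x) \<in> V.span ((P \<circ> f) ` (J - {x}))" by simp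
  then have "(P \<circ> f) ` J \<subseteq> V.span ((P \<circ> f) ` (J - {x}))"
    by (auto intro: V.span_base)
  then have "V.span ((P \<circ> f) ` J) \<subseteq> V.span ((P \<circ> f) ` (J - {x}))"
    using V.span_minimal V.subspace_span by blast
  then have sub: "D ` J \<subseteq> V.span ((P \<circ> f) ` (J - {x}))" using D by auto
  have Dinj: "inj_on D J"
    by (rule inj_onI) (metis D_def zero_neq_one)
  have "V.independent (D ` J)"
  proof (rule V.independent_if_scalars_zero)
    show "finite (D ` J)" using J by simp
    fix u v assume *: "(\<Sum>w\<in>D ` J. (\<lambda>i. u w * w i)) = 0" "v \<in> D ` J"
    then obtain j where j: "j \<in> J" "v = D j" by blast
    have "0 = (\<Sum>w\<in>D ` J. (\<lambda>i. u w * w i)) j" using * by simp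
    also have "\<dots> = (\<Sum>k\<in>J. u (D k) * D k j)"
      by (simp add: sum_fun_apply sum.reindex[OF Dinj])
    also have "\<dots> = u (D j)" using J j by (simp add: D_def sum.delta if_distrib cong: if_cong)
    finally show "u v = 0" using j by simp
  qed
  then have "card (D ` J) \<le> card ((P \<circ> f) ` (J - {x}))"
    using V.independent_span_bound[OF _ _ sub] J by blast
  also have "\<dots> \<le> card (J - {x})" by (rule card_image_le) (use J in simp)
  also have "\<dots> < card J" using J xJ by (metis card_Diff1_less)
  finally show False using card_image[OF Dinj] by simp
qed

end

section \<open>Skew-commuting monomials\<close>

lemma skew_tw_simp: "skew_tw p (a1, a2, a3) (b1, b2, b3) = 
    p 1 2 ^ (a2 * b1) * p 1 3 ^ (a3 * b1) * p 2 3 ^ (a3 * b2)"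
  by (simp add: skew_tw_def)

fun tdeg :: "(nat \<times> nat \<times> nat) \<times> nat \<Rightarrow> nat"
  where "tdeg ((a, b, c), n) = a + b + c + n"

lemma tdeg_add: "tdeg (x + y) = tdeg x + tdeg y"
  by (cases x rule: tdeg.cases; cases y rule: tdeg.cases) simp

lemma finite_tdeg: "finite {x. tdeg x \<le> n}"
proof (rule finite_subset)
  show "{x. tdeg x \<le> n} \<subseteq> ({..n} \<times> {..n} \<times> {..n}) \<times> {..n}"
    by (auto simp: mem_Times_iff)
qed simp

lemma tdeg_bounded: "finite D \<Longrightarrow> \<exists>n. D \<subseteq> {x. tdeg x \<le> n}"
  using finite_nat_set_iff_bounded_le[of "tdeg ` D"] by (auto simp: image_iff)

context kalg
begin

lemma pow_comm_1:
  assumes [simp]: "u \<in> carrier R" "v \<in> carrier R" and vu: "v \<otimes> u = c \<star> (u \<otimes> v)"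
  shows "v [^] (b::nat) \<otimes> u = c ^ b \<star> (u \<otimes> v [^] b)"
proof (induction b)
  case (Suc b)
  have "v [^] Suc b \<otimes> u = v [^] b \<otimes> (v \<otimes> u)" by (simp add: m_assoc)
  also have "\<dots> = c \<star> ((v [^] b \<otimes> u) \<otimes> v)" by (simp add: vu m_assoc)
  also have "\<dots> = c ^ Suc b \<star> (u \<otimes> v [^] Suc b)" by (simp add: Suc m_assoc)
  finally show ?case .
qed simp

lemma pow_comm:
  assumes [simp]: "u \<in> carrier R" "v \<in> carrier R" and vu: "v \<otimes> u = c \<star> (u \<otimes> v)"
  shows "v [^] (b::nat) \<otimes> u [^] (a::nat) = c ^ (b * a) \<star> (u [^] a \<otimes> v [^] b)"
proof (induction a)
  case (Suc a)
  have "v [^] b \<otimes> u [^] Suc a = (v [^] b \<otimes> u [^] a) \<otimes> u" by (simp add: m_assoc)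
  also have "\<dots> = c ^ (b * a) \<star> (u [^] a \<otimes> (v [^] b \<otimes> u))" by (simp add: Suc m_assoc)
  also have "\<dots> = c ^ (b * Suc a) \<star> (u [^] Suc a \<otimes> v [^] b)"
    by (simp add: pow_comm_1[OF assms] m_assoc power_add mult.commute)
  finally show ?case .
qed simp

end

text \<open>Such a triple is the image of the generators under a homomorphism from
  \<open>skew_poly p\<close>; spanning and independence of its monomials are separate
  questions.\<close>

locale qtriple = kalg R eta for R (structure) and eta :: "'k::field \<Rightarrow> 'a" +
  fixes p :: "nat \<Rightarrow> nat \<Rightarrow> 'k" and u1 u2 u3 :: 'a
  assumes u_closed [simp, intro]: "u1 \<in> carrier R" "u2 \<in> carrier R" "u3 \<in> carrier R"
    and u21: "u2 \<otimes> u1 = p 1 2 \<star> (u1 \<otimes> u2)"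
    and u31: "u3 \<otimes> u1 = p 1 3 \<star> (u1 \<otimes> u3)"
    and u32: "u3 \<otimes> u2 = p 2 3 \<star> (u2 \<otimes> u3)"
begin

fun tmon :: "nat \<times> nat \<times> nat \<Rightarrow> 'a"
  where "tmon (a, b, c) = u1 [^] a \<otimes> u2 [^] b \<otimes> u3 [^] c"

lemma tmon_closed [simp, intro]: "tmon m \<in> carrier R"
  by (cases m rule: tmon.cases) simp

text \<open>Sorting the product moves \<open>u3\<close> past \<open>u1\<close>, \<open>u2\<close>
  past \<open>u1\<close> and \<open>u3\<close> past \<open>u2\<close>; these three crossings produce
  the three factors of \<open>skew_tw\<close>.\<close>

lemma tmon_mult: "tmon m \<otimes> tmon m' = skew_tw p m m' \<star> tmon (m + m')"
proof -
  obtain a b c where m: "m = (a, b, c)" by (cases m)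
  obtain a' b' c' where m': "m' = (a', b', c')" by (cases m')
  have "tmon m \<otimes> tmon m' = u1 [^] a \<otimes> u2 [^] b \<otimes> ((u3 [^] c \<otimes> u1 [^] a') \<otimes> (u2 [^] b' \<otimes> u3 [^] c'))"
    by (simp add: m m' m_assoc)
  also have "\<dots> = p 1 3 ^ (c * a') \<star> 
      (u1 [^] a \<otimes> (u2 [^] b \<otimes> u1 [^] a') \<otimes> ((u3 [^] c \<otimes> u2 [^] b') \<otimes> u3 [^] c'))"
    by (simp add: pow_comm[OF _ _ u31] m_assoc)
  also have "\<dots> = skew_tw p m m' \<star> 
      (u1 [^] a \<otimes> u1 [^] a' \<otimes> (u2 [^] b \<otimes> u2 [^] b') \<otimes> (u3 [^] c \<otimes> u3 [^] c'))"
    by (simp add: pow_comm[OF _ _ u21] pow_comm[OF _ _ u32] m_assoc skew_tw_simp m m' mult_ac)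
  also have "\<dots> = skew_tw p m m' \<star> tmon (m + m')"
    by (simp add: m m' nat_pow_mult)
  finally show ?thesis .
qed

end

text \<open>The central element \<open>t\<close> lets the same monomials describe \<open>A[t]\<close> and \<open>B[t]\<close>.\<close>

locale qquad = qtriple R eta p u1 u2 u3
  for R (structure) and eta :: "'k::field \<Rightarrow> 'a" and p :: "nat \<Rightarrow> nat \<Rightarrow> 'k" and u1 u2 u3 :: 'a +
  fixes t :: 'a
  assumes t_closed [simp, intro]: "t \<in> carrier R"
    and t_central: "x \<in> carrier R \<Longrightarrow> t \<otimes> x = x \<otimes> t"
begin

fun qmon :: "(nat \<times> nat \<times> nat) \<times> nat \<Rightarrow> 'a"
  where "qmon (m, n) = tmon m \<otimes> t [^] n"

lemma qmon_closed [simp, intro]: "qmon x \<in> carrier R"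
  by (cases x rule: qmon.cases) simp

lemma qmon_range [simp]: "range qmon \<subseteq> carrier R"
  by auto

lemma qmon_mult: "qmon x \<otimes> qmon y = skew_tw p (fst x) (fst y) \<star> qmon (x + y)"
proof -
  obtain m n where x: "x = (m, n)" by (cases x)
  obtain m' n' where y: "y = (m', n')" by (cases y)
  have "x' \<in> carrier R \<Longrightarrow> t [^] n \<otimes> x' = x' \<otimes> t [^] n" for x'
    using pow_comm_1[of x' t 1 n] t_central by simp
  then have "qmon x \<otimes> qmon y = tmon m \<otimes> tmon m' \<otimes> (t [^] n \<otimes> t [^] n')"
    by (simp add: x y m_assoc)
  also have "\<dots> = skew_tw p (fst x) (fst y) \<star> qmon (x + y)"
    by (simp add: x y tmon_mult nat_pow_mult)
  finally show ?thesis .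
qed

lemma qmon_0: "qmon ((0, 0, 0), 0) = \<one>" and
  qmon_gen: "qmon ((1, 0, 0), 0) = u1" "qmon ((0, 1, 0), 0) = u2" "qmon ((0, 0, 1), 0) = u3"
    "qmon ((0, 0, 0), 1) = t"
  by simp_all

lemma pow_mem_sub: 
  assumes "\<one> \<in> S" "\<And>x y. x \<in> S \<Longrightarrow> y \<in> S \<Longrightarrow> x \<otimes> y \<in> S" "x \<in> S"
  shows "x [^] (n::nat) \<in> S"
  by (induction n) (use assms in auto)

lemma qmon_mem_sub:
  assumes "\<one> \<in> S" "\<And>x y. x \<in> S \<Longrightarrow> y \<in> S \<Longrightarrow> x \<otimes> y \<in> S" "{u1, u2, u3, t} \<subseteq> S"
  shows "qmon x \<in> S"
proof -
  obtain a b c n where x: "x = ((a, b, c), n)" by (metis prod.exhaust)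
  show ?thesis unfolding x using assms pow_mem_sub[OF assms(1,2)] by auto
qed

text \<open>With a predicate instead of a bound, one multiplication lemma serves both the increasing
  filtration (degree at most n) and the decreasing one (degree at least n), which plays the part of
  the powers of the augmentation ideal.\<close>

abbreviation qspan :: "(nat \<Rightarrow> bool) \<Rightarrow> 'a set"
  where "qspan P \<equiv> lspan (qmon ` {x. P (tdeg x)})"

lemma qspan_mult:
  assumes "x \<in> qspan P" "y \<in> qspan Q" "\<And>a b. P a \<Longrightarrow> Q b \<Longrightarrow> P' (a + b)"
  shows "x \<otimes> y \<in> qspan P'"
proof (rule lspan_mult[OF assms(1,2)])
  fix v w assume "v \<in> qmon ` {x. P (tdeg x)}" "w \<in> qmon ` {x. Q (tdeg x)}"
  then obtain i j where ij: "v = qmon i" "w = qmon j" "P (tdeg i)" "Q (tdeg j)" by blast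
  then have "P' (tdeg (i + j))" using assms(3) by (simp add: tdeg_add)
  then show "v \<otimes> w \<in> qspan P'"
    unfolding ij qmon_mult by (intro lspan_smul lspan_base imageI CollectI qmon_closed)
qed

lemma one_qspan: "P 0 \<Longrightarrow> \<one> \<in> qspan P"
  using lspan_base[of "qmon ((0,0,0),0)" "qmon ` {x. P (tdeg x)}"] qmon_0
  by (metis (mono_tags, lifting) add_0 imageI mem_Collect_eq one_closed tdeg.simps)

lemma gen_qspan: "P 1 \<Longrightarrow> {u1, u2, u3, t} \<subseteq> qspan P"
proof -
  assume P: "P 1"
  have "qmon x \<in> qspan P" if "tdeg x = 1" for x
    by (rule lspan_base) (use that P in auto)
  from this[of "((1, 0, 0), 0)"] this[of "((0, 1, 0), 0)"] this[of "((0, 0, 1), 0)"] 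
    this[of "((0, 0, 0), 1)"]
  show ?thesis unfolding qmon_gen by simp
qed

lemma pow_graded_mem:
  assumes "\<And>n. S n \<subseteq> carrier R" "\<one> \<in> S 0" 
    "\<And>x y a b. \<lbrakk>x \<in> S a; y \<in> S b\<rbrakk> \<Longrightarrow> x \<otimes> y \<in> S (a + b)" "x \<in> S 1"
  shows "x [^] (n::nat) \<in> S n"
proof (induction n)
  case (Suc n)
  then show ?case using assms(3)[OF Suc assms(4)] by simp
qed (use assms in simp)

text \<open>Applied to three multiplicative filtrations \<open>S\<close>: monomials of degree at
  most n, monomials of degree at least n, and the kernel of an augmentation from degree 1
  on.\<close>

lemma qmon_graded_mem:
  assumes "\<And>n. S n \<subseteq> carrier R" "\<one> \<in> S 0" 
    "\<And>x y a b. \<lbrakk>x \<in> S a; y \<in> S b\<rbrakk> \<Longrightarrow> x \<otimes> y \<in> S (a + b)" "{u1, u2, u3, t} \<subseteq> S 1"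
  shows "qmon x \<in> S (tdeg x)"
proof -
  obtain a b c n where x: "x = ((a, b, c), n)" by (metis prod.exhaust)
  note pow = pow_graded_mem[OF assms(1-3)]
  show ?thesis unfolding x qmon.simps tmon.simps tdeg.simps
    using assms(4) by (intro assms(3) pow) auto
qed

lemma lspan_range_mult: "\<lbrakk>x \<in> lspan (range qmon); y \<in> lspan (range qmon)\<rbrakk> \<Longrightarrow> x \<otimes> y \<in> lspan (range qmon)"
  using qspan_mult[of x "\<lambda>_. True" y "\<lambda>_. True" "\<lambda>_. True"] by simp

end

section \<open>Comparing two systems of skew-commuting generators\<close>

context kalg
begin

context
  fixes p :: "nat \<Rightarrow> nat \<Rightarrow> 'k" and y1 y2 y3 y4 z1 z2 z3 z4 :: 'a
  assumes y: "qquad R eta p y1 y2 y3 y4" and z: "qquad R eta p z1 z2 z3 z4"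
begin

interpretation Y: qquad R eta p y1 y2 y3 y4 by (rule y)
interpretation Z: qquad R eta p z1 z2 z3 z4 by (rule z)

lemma translate_full:
  assumes full: "lspan (range Y.qmon) = carrier R"
    and gens: "{y1, y2, y3, y4} \<subseteq> Z.qspan (\<lambda>n. n \<le> 1)"
  shows "lspan (range Z.qmon) = carrier R"
proof -
  have mono: "Z.qspan (\<lambda>n. n \<le> 1) \<subseteq> lspan (range Z.qmon)" by (rule lspan_mono) auto
  have "Y.qmon x \<in> lspan (range Z.qmon)" for x
    by (rule Y.qmon_mem_sub)
      (use gens mono Z.one_qspan[of "\<lambda>n. n \<le> 1"] Z.lspan_range_mult in auto)
  then have "carrier R \<subseteq> lspan (range Z.qmon)" unfolding full[symmetric]
    using lspan_sub[of _ "range Y.qmon"] by blast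
  then show ?thesis using lspan_carrier by blast
qed

text \<open>Because the change of generators is affine, \<open>Y\<close>-monomials of degree at most
  n lie in the span of \<open>Z\<close>-monomials of degree at most n. There are equally many of
  both kinds, so the latter are independent by \<open>indep_mod\<close>.\<close>

lemma translate_indep:
  assumes ind: "indep Y.qmon" and full: "lspan (range Y.qmon) = carrier R"
    and gens: "{y1, y2, y3, y4} \<subseteq> Z.qspan (\<lambda>n. n \<le> 1)"
  shows "indep Z.qmon"
  unfolding indep_def
proof (intro allI impI)
  fix d x
  assume d: "finite {x. d x \<noteq> 0}" "lcomb Z.qmon d = \<zero>"
  obtain n where dJ: "{x. d x \<noteq> 0} \<subseteq> {x. tdeg x \<le> n}"
    using tdeg_bounded[OF d(1)] by blast
  let ?J = "{x. tdeg x \<le> n}"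
  have gr: "Y.qmon x \<in> Z.qspan (\<lambda>k. k \<le> tdeg x)" for x
  proof (rule Y.qmon_graded_mem[where S = "\<lambda>n. Z.qspan (\<lambda>k. k \<le> n)"])
    show "x \<otimes> y \<in> Z.qspan (\<lambda>k. k \<le> a + b)" 
      if "x \<in> Z.qspan (\<lambda>k. k \<le> a)" "y \<in> Z.qspan (\<lambda>k. k \<le> b)" for x y a b
      by (rule Z.qspan_mult[OF that]) simp
  qed (use gens lspan_carrier Z.one_qspan[of "\<lambda>k. k \<le> 0"] in auto)
  have gen: "Y.qmon x \<in> lspan (Z.qmon ` ?J \<union> Y.qmon ` (- ?J))" if "x \<in> ?J" for x
  proof -
    have "Z.qspan (\<lambda>k. k \<le> tdeg x) \<subseteq> lspan (Z.qmon ` ?J \<union> Y.qmon ` (- ?J))"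
      by (rule lspan_mono) (use that in auto)
    then show ?thesis using gr by blast
  qed
  show "d x = 0"
    by (rule indep_mod[OF Y.qmon_range ind full Z.qmon_range finite_tdeg gen dJ]) (use d in auto)
qed

text \<open>A \<open>Z\<close>-monomial of degree above n only involves \<open>Y\<close>-monomials
  of degree above n. Modulo the span of these, the \<open>Z\<close>-monomials of degree at most n
  span a space with as many basis vectors, so they are independent. A given relation has bounded
  support, so one n is enough for it.\<close>

lemma hopf_indep:
  assumes ind: "indep Y.qmon" and full: "lspan (range Y.qmon) = carrier R"
    and fullz: "lspan (range Z.qmon) = carrier R"
    and gens: "{z1, z2, z3, z4} \<subseteq> Y.qspan (\<lambda>n. n \<ge> 1)"
  shows "indep Z.qmon"
  unfolding indep_def
proof (intro allI impI)
  fix d x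
  assume d: "finite {x. d x \<noteq> 0}" "lcomb Z.qmon d = \<zero>"
  obtain n where dJ: "{x. d x \<noteq> 0} \<subseteq> {x. tdeg x \<le> n}"
    using tdeg_bounded[OF d(1)] by blast
  let ?J = "{x. tdeg x \<le> n}"
  have gr: "Z.qmon x \<in> Y.qspan (\<lambda>k. k \<ge> tdeg x)" for x
  proof (rule Z.qmon_graded_mem[where S = "\<lambda>n. Y.qspan (\<lambda>k. k \<ge> n)"])
    show "x \<otimes> y \<in> Y.qspan (\<lambda>k. k \<ge> a + b)" 
      if "x \<in> Y.qspan (\<lambda>k. k \<ge> a)" "y \<in> Y.qspan (\<lambda>k. k \<ge> b)" for x y a b
      by (rule Y.qspan_mult[OF that]) simp
  qed (use gens lspan_carrier Y.one_qspan[of "\<lambda>k. k \<ge> 0"] in auto)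
  have "Z.qmon x \<in> lspan (Z.qmon ` ?J \<union> Y.qmon ` (- ?J))" for x
  proof (cases "x \<in> ?J")
    case True
    then show ?thesis by (intro lspan_base) auto
  next
    case False
    then have "Y.qspan (\<lambda>k. k \<ge> tdeg x) \<subseteq> lspan (Z.qmon ` ?J \<union> Y.qmon ` (- ?J))"
      by (intro lspan_mono) auto
    then show ?thesis using gr by blast
  qed
  then have "lspan (range Z.qmon) \<subseteq> lspan (Z.qmon ` ?J \<union> Y.qmon ` (- ?J))"
    using lspan_sub[of _ "range Z.qmon"] by blast
  then have gen: "Y.qmon x \<in> lspan (Z.qmon ` ?J \<union> Y.qmon ` (- ?J))" if "x \<in> ?J" for x
    using fullz by auto
  show "d x = 0"
    by (rule indep_mod[OF Y.qmon_range ind full Z.qmon_range finite_tdeg gen dJ]) (use d in auto)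
qed

end

end

section \<open>The skew polynomial ring\<close>

lemma finite_add_pairs: "finite {(a, b). a + b = (m :: nat \<times> nat \<times> nat)}"
proof (rule finite_subset)
  let ?S = "{..fst m} \<times> {..fst (snd m)} \<times> {..snd (snd m)}"
  show "{(a, b). a + b = m} \<subseteq> ?S \<times> ?S" by auto
qed simp

lemma skew_tw_add_left: "skew_tw p (a + a') b = skew_tw p a b * skew_tw p a' b"
  by (cases a; cases a'; cases b) (simp add: skew_tw_simp algebra_simps power_add)

lemma skew_tw_add_right: "skew_tw p a (b + b') = skew_tw p a b * skew_tw p a b'"
  by (cases a; cases b; cases b') (simp add: skew_tw_simp algebra_simps power_add)

lemma skew_tw_0 [simp]: "skew_tw p (0, 0, 0) a = 1" "skew_tw p a (0, 0, 0) = 1"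
  by (cases a; simp add: skew_tw_simp)+

text \<open>Summing over pairs with a given sum removes truncated subtraction; associativity then
  becomes a reindexing of triples.\<close>

lemma skew_mult_pairs:
  "skew_mult p f g m = (\<Sum>(a, b)\<in>{(a, b). a + b = m}. f a * g b * skew_tw p a b)"
proof -
  obtain m1 m2 m3 where m: "m = (m1, m2, m3)" by (cases m)
  have "skew_mult p f g m = (\<Sum>(a1, a2, a3)\<in>{..m1} \<times> {..m2} \<times> {..m3}.
        f (a1, a2, a3) * g (m1 - a1, m2 - a2, m3 - a3) *
        skew_tw p (a1, a2, a3) (m1 - a1, m2 - a2, m3 - a3))"
    by (simp add: skew_mult_def m sum.cartesian_product split_def)
  also have "\<dots> = (\<Sum>(a, b)\<in>{(a, b). a + b = m}. f a * g b * skew_tw p a b)"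
    by (rule sum.reindex_bij_witness[where j = "\<lambda>(a1, a2, a3). ((a1, a2, a3), (m1 - a1, m2 - a2, m3 - a3))"
          and i = fst]) (auto simp: m)
  finally show ?thesis .
qed

lemma skew_mult_supp:
  "{m. skew_mult p f g m \<noteq> 0} \<subseteq> (\<lambda>(a, b). a + b) ` ({a. f a \<noteq> 0} \<times> {b. g b \<noteq> 0})"
proof
  fix m assume "m \<in> {m. skew_mult p f g m \<noteq> 0}"
  then have "(\<Sum>(a, b)\<in>{(a, b). a + b = m}. f a * g b * skew_tw p a b) \<noteq> 0"
    by (simp add: skew_mult_pairs)
  then obtain x where "x \<in> {(a, b). a + b = m}" "(case x of (a, b) \<Rightarrow> f a * g b * skew_tw p a b) \<noteq> 0"
    by (rule sum.not_neutral_contains_not_neutral)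
  then show "m \<in> (\<lambda>(a, b). a + b) ` ({a. f a \<noteq> 0} \<times> {b. g b \<noteq> 0})" by force
qed

lemma skew_mult_finite:
  assumes "finite {m. f m \<noteq> 0}" "finite {m. g m \<noteq> 0}"
  shows "finite {m. skew_mult p f g m \<noteq> 0}"
  by (rule finite_subset[OF skew_mult_supp]) (use assms in auto)

text \<open>The twist is multiplicative in each argument, so both bracketings carry the same product
  of three pairwise twists.\<close>

lemma skew_mult_assoc: "skew_mult p (skew_mult p f g) h = skew_mult p f (skew_mult p g h)"
proof
  fix m :: "nat \<times> nat \<times> nat"
  let ?P = "\<lambda>m :: nat \<times> nat \<times> nat. {(a, b). a + b = m}"
  let ?t = "\<lambda>a b c. f a * g b * h c * (skew_tw p a b * skew_tw p a c * skew_tw p b c)"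
  have "skew_mult p (skew_mult p f g) h m = (\<Sum>(x, c)\<in>?P m. \<Sum>(a, b)\<in>?P x. ?t a b c)"
    unfolding skew_mult_pairs[of p "skew_mult p f g"]
  proof (intro sum.cong refl, clarify)
    fix x c
    show "skew_mult p f g x * h c * skew_tw p x c = (\<Sum>(a, b)\<in>?P x. ?t a b c)"
      unfolding skew_mult_pairs sum_distrib_right
    proof (intro sum.cong refl)
      fix y assume "y \<in> ?P x"
      then obtain a b where "y = (a, b)" "x = a + b" by blast
      then show "(case y of (a, b) \<Rightarrow> f a * g b * skew_tw p a b) * h c * skew_tw p x c =
          (case y of (a, b) \<Rightarrow> ?t a b c)"
        by (simp add: skew_tw_add_left mult_ac)
    qed
  qed
  also have "\<dots> = (\<Sum>((x, c), (a, b))\<in>Sigma (?P m) (\<lambda>(x, c). ?P x). ?t a b c)"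
    by (simp add: split_def sum.Sigma finite_add_pairs[unfolded split_def])
  also have "\<dots> = (\<Sum>((a, x), (b, c))\<in>Sigma (?P m) (\<lambda>(a, x). ?P x). ?t a b c)"
    by (rule sum.reindex_bij_witness[where j = "\<lambda>((x, c), (a, b)). ((a, b + c), (b, c))"
          and i = "\<lambda>((a, x), (b, c)). ((a + b, c), (a, b))"]) (auto simp: add.assoc)
  also have "\<dots> = (\<Sum>(a, x)\<in>?P m. \<Sum>(b, c)\<in>?P x. ?t a b c)"
    by (simp add: split_def sum.Sigma finite_add_pairs[unfolded split_def])
  also have "\<dots> = skew_mult p f (skew_mult p g h) m"
    unfolding skew_mult_pairs[of p f]
  proof (intro sum.cong refl, clarify)
    fix a x
    show "(\<Sum>(b, c)\<in>?P x. ?t a b c) = f a * skew_mult p g h x * skew_tw p a x"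
      unfolding skew_mult_pairs sum_distrib_right sum_distrib_left
    proof (intro sum.cong refl)
      fix y assume "y \<in> ?P x"
      then obtain b c where "y = (b, c)" "x = b + c" by blast
      then show "(case y of (b, c) \<Rightarrow> ?t a b c) = 
          f a * (case y of (b, c) \<Rightarrow> g b * h c * skew_tw p b c) * skew_tw p a x"
        by (simp add: skew_tw_add_right mult_ac)
    qed
  qed
  finally show "skew_mult p (skew_mult p f g) h m = skew_mult p f (skew_mult p g h) m" .
qed

definition single :: "nat \<times> nat \<times> nat \<Rightarrow> 'k \<Rightarrow> nat \<times> nat \<times> nat \<Rightarrow> 'k::field"
  where "single a c = (\<lambda>m. if m = a then c else 0)"

lemma single_scale: "(\<lambda>m. c * single a d m) = single a (c * d)"
  by (auto simp: single_def)

lemma single_finite [simp]: "finite {m. single a c m \<noteq> 0}"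
  by (rule finite_subset[of _ "{a}"]) (auto simp: single_def)

lemma skew_mult_single: "skew_mult p (single a c) (single b d) = single (a + b) (c * d * skew_tw p a b)"
proof
  fix m
  have "skew_mult p (single a c) (single b d) m = 
    (\<Sum>x\<in>{(a, b). a + b = m}. if x = (a, b) then c * d * skew_tw p a b else 0)"
    unfolding skew_mult_pairs by (rule sum.cong) (auto simp: single_def split: if_splits)
  also have "\<dots> = single (a + b) (c * d * skew_tw p a b) m"
    using finite_add_pairs[of m] by (auto simp: single_def split: if_splits)
  finally show "skew_mult p (single a c) (single b d) m = single (a + b) (c * d * skew_tw p a b) m" .
qed

lemma skew_mult_single_left_0: "skew_mult p (single (0, 0, 0) c) f = (\<lambda>m. c * f m)"
proof
  fix m :: "nat \<times> nat \<times> nat"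
  have z: "((0, 0, 0), m) \<in> {(a, b). a + b = m}" by (simp add: zero_prod_def)
  have "skew_mult p (single (0, 0, 0) c) f m = 
    (\<Sum>x\<in>{(a, b). a + b = m}. if x = ((0, 0, 0), m) then c * f m else 0)"
    unfolding skew_mult_pairs by (rule sum.cong) (auto simp: single_def split: if_splits)
  also have "\<dots> = c * f m" using finite_add_pairs[of m] z by (subst sum.delta) auto
  finally show "skew_mult p (single (0, 0, 0) c) f m = c * f m" .
qed

lemma skew_mult_single_right_0: "skew_mult p f (single (0, 0, 0) c) = (\<lambda>m. c * f m)"
proof
  fix m :: "nat \<times> nat \<times> nat"
  have z: "(m, (0, 0, 0)) \<in> {(a, b). a + b = m}" by (simp add: zero_prod_def)
  have "skew_mult p f (single (0, 0, 0) c) m = 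
    (\<Sum>x\<in>{(a, b). a + b = m}. if x = (m, (0, 0, 0)) then c * f m else 0)"
    unfolding skew_mult_pairs by (rule sum.cong) (auto simp: single_def split: if_splits)
  also have "\<dots> = c * f m" using finite_add_pairs[of m] z by (subst sum.delta) auto
  finally show "skew_mult p f (single (0, 0, 0) c) m = c * f m" .
qed

lemma skew_mult_add_left: "skew_mult p (\<lambda>m. f m + f' m) g = (\<lambda>m. skew_mult p f g m + skew_mult p f' g m)"
  unfolding skew_mult_pairs sum.distrib[symmetric] 
  by (intro ext sum.cong) (auto simp: algebra_simps)

lemma skew_mult_add_right: "skew_mult p g (\<lambda>m. f m + f' m) = (\<lambda>m. skew_mult p g f m + skew_mult p g f' m)"
  unfolding skew_mult_pairs sum.distrib[symmetric] 
  by (intro ext sum.cong) (auto simp: algebra_simps)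

lemma skew_poly_sel:
  "carrier (skew_poly p) = {f. finite {m. f m \<noteq> 0}}"
  "f \<otimes>\<^bsub>skew_poly p\<^esub> g = skew_mult p f g"
  "\<one>\<^bsub>skew_poly p\<^esub> = single (0, 0, 0) 1"
  "\<zero>\<^bsub>skew_poly p\<^esub> = (\<lambda>m. 0)"
  "f \<oplus>\<^bsub>skew_poly p\<^esub> g = (\<lambda>m. f m + g m)"
  by (simp_all add: skew_poly_def single_def)

lemma skew_unit_single: "skew_unit p c = single (0, 0, 0) c"
  by (simp add: skew_unit_def single_def)

lemma ring_skew_poly: "ring (skew_poly p)"
proof (rule ringI)
  show "abelian_group (skew_poly p)"
  proof (rule abelian_groupI)
    fix f assume f: "f \<in> carrier (skew_poly p)"
    then have "(\<lambda>m. - f m) \<in> carrier (skew_poly p)" by (simp add: skew_poly_sel)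
    moreover have "(\<lambda>m. - f m) \<oplus>\<^bsub>skew_poly p\<^esub> f = \<zero>\<^bsub>skew_poly p\<^esub>" by (simp add: skew_poly_sel)
    ultimately show "\<exists>g\<in>carrier (skew_poly p). g \<oplus>\<^bsub>skew_poly p\<^esub> f = \<zero>\<^bsub>skew_poly p\<^esub>" by blast
  qed (auto simp: skew_poly_sel add_ac intro: finite_supp_add)
  show "Group.monoid (skew_poly p)"
    by (rule monoidI) (auto simp: skew_poly_sel skew_mult_assoc skew_mult_finite
        skew_mult_single_left_0 skew_mult_single_right_0)
qed (auto simp: skew_poly_sel skew_mult_add_left skew_mult_add_right)

lemma kalg_skew_poly: "kalg (skew_poly p) (skew_unit p)"
proof (intro kalg.intro kalg_axioms.intro ring_skew_poly)
  show "skew_unit p (a * b) = skew_unit p a \<otimes>\<^bsub>skew_poly p\<^esub> skew_unit p b" for a b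
    unfolding skew_unit_single skew_poly_sel skew_mult_single by simp
  show "skew_unit p (a + b) = skew_unit p a \<oplus>\<^bsub>skew_poly p\<^esub> skew_unit p b" for a b
    by (simp add: skew_unit_def skew_poly_sel fun_eq_iff)
qed (simp_all add: skew_poly_sel skew_unit_single skew_mult_single_left_0 skew_mult_single_right_0)

definition nc_domain :: "('a, 'm) ring_scheme \<Rightarrow> bool"
  where "nc_domain R \<longleftrightarrow> \<one>\<^bsub>R\<^esub> \<noteq> \<zero>\<^bsub>R\<^esub> \<and> (\<forall>x\<in>carrier R. \<forall>y\<in>carrier R. x \<otimes>\<^bsub>R\<^esub> y = \<zero>\<^bsub>R\<^esub> \<longrightarrow> x = \<zero>\<^bsub>R\<^esub> \<or> y = \<zero>\<^bsub>R\<^esub>)"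

text \<open>Leading monomials with respect to the lexicographic order are multiplicative up to a nonzero
  twist.\<close>

lemma nc_domain_skew_poly:
  assumes p: "p 1 2 \<noteq> 0" "p 1 3 \<noteq> 0" "p 2 3 \<noteq> 0"
  shows "nc_domain (skew_poly p)"
  unfolding nc_domain_def skew_poly_sel
proof (intro conjI ballI impI)
  show "single (0, 0, 0) 1 \<noteq> (\<lambda>m. 0 :: 'a)" by (auto simp: single_def fun_eq_iff)
  fix f g :: "nat \<times> nat \<times> nat \<Rightarrow> 'a"
  assume fin: "f \<in> {f. finite {m. f m \<noteq> 0}}" "g \<in> {f. finite {m. f m \<noteq> 0}}"
    and z: "skew_mult p f g = (\<lambda>m. 0)"
  show "f = (\<lambda>m. 0) \<or> g = (\<lambda>m. 0)"
  proof (rule ccontr)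
    assume "\<not> (f = (\<lambda>m. 0) \<or> g = (\<lambda>m. 0))"
    then have ne: "{m. f m \<noteq> 0} \<noteq> {}" "{m. g m \<noteq> 0} \<noteq> {}" by auto
    define a where "a = Max {m. f m \<noteq> 0}"
    define b where "b = Max {m. g m \<noteq> 0}"
    have a: "f a \<noteq> 0" "\<And>m. f m \<noteq> 0 \<Longrightarrow> m \<le> a"
      using Max_in[OF _ ne(1)] fin by (auto simp: a_def)
    have b: "g b \<noteq> 0" "\<And>m. g m \<noteq> 0 \<Longrightarrow> m \<le> b"
      using Max_in[OF _ ne(2)] fin by (auto simp: b_def)
    \<comment> \<open>Addition is strictly monotone for the order, so the exponent
      \<open>a + b\<close> arises from the two leading exponents alone.\<close>
    have lex: "a' = a \<and> b' = b" if "a' \<le> a" "b' \<le> b" "a' + b' = a + b" for a' b'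
      using that by (cases a; cases b; cases a'; cases b') auto
    have "skew_mult p f g (a + b) = 
        (\<Sum>x\<in>{(a', b'). a' + b' = a + b}. if x = (a, b) then f a * g b * skew_tw p a b else 0)"
      unfolding skew_mult_pairs
    proof (intro sum.cong refl, clarify)
      fix a' b' assume s: "a' + b' = a + b"
      have "f a' = 0 \<or> g b' = 0 \<or> a' = a \<and> b' = b" using lex a(2) b(2) s by blast
      then show "f a' * g b' * skew_tw p a' b' = (if (a', b') = (a, b) then f a * g b * skew_tw p a b else 0)"
        using a(1) b(1) by auto
    qed
    also have "\<dots> = f a * g b * skew_tw p a b" by (simp add: finite_add_pairs)
    also have "\<dots> \<noteq> 0" using a b p by (cases a; cases b) (simp add: skew_tw_simp)
    finally show False using z by simp
  qed
qed

section \<open>The PBW basis of the skew polynomial ring\<close>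

interpretation A: kalg "skew_poly p" "skew_unit p" for p
  by (rule kalg_skew_poly)

abbreviation "sx1 \<equiv> single (Suc 0, 0, 0) 1"
abbreviation "sx2 \<equiv> single (0, Suc 0, 0) 1"
abbreviation "sx3 \<equiv> single (0, 0, Suc 0) 1"

lemma A_smul: "A.smul p c f = (\<lambda>m. c * f m)"
  by (simp add: A.smul_def skew_unit_single skew_poly_sel skew_mult_single_left_0)

lemma qtriple_skew_poly: "qtriple (skew_poly p) (skew_unit p) p sx1 sx2 sx3"
  by unfold_locales
    (simp_all add: skew_poly_sel(1,2) A_smul skew_mult_single skew_tw_simp single_scale)

interpretation AQ: qtriple "skew_poly p" "skew_unit p" p sx1 sx2 sx3 for p
  by (rule qtriple_skew_poly)

lemma A_pow: "sx1 [^]\<^bsub>skew_poly p\<^esub> (n::nat) = single (n, 0, 0) 1"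
  "sx2 [^]\<^bsub>skew_poly p\<^esub> (n::nat) = single (0, n, 0) 1"
  "sx3 [^]\<^bsub>skew_poly p\<^esub> (n::nat) = single (0, 0, n) 1"
  by (induction n) (simp_all add: skew_poly_sel(2,3) skew_mult_single skew_tw_simp)

lemma AQ_tmon: "AQ.tmon p m = single m 1"
proof -
  obtain a b c where m: "m = (a, b, c)" by (cases m)
  show ?thesis unfolding m AQ.tmon.simps A_pow
    by (simp add: skew_poly_sel(2) skew_mult_single skew_tw_simp)
qed

text \<open>An element of the model is its own coordinate function; spanning and independence of the
  monomials are both read off from this.\<close>

lemma A_lcomb: "finite {m. d m \<noteq> 0} \<Longrightarrow> A.lcomb p (AQ.tmon p) d = d"
proof -
  assume fin: "finite {m. d m \<noteq> 0}"
  have "finite S \<Longrightarrow> (\<Oplus>\<^bsub>skew_poly p\<^esub>m\<in>S. single m (d m)) = (\<lambda>m. if m \<in> S then d m else 0)" for S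
  proof (induction rule: finite_induct)
    case empty
    then show ?case by (simp add: skew_poly_sel)
  next
    case (insert x S)
    have "(\<Oplus>\<^bsub>skew_poly p\<^esub>m\<in>insert x S. single m (d m)) = 
      single x (d x) \<oplus>\<^bsub>skew_poly p\<^esub> (\<Oplus>\<^bsub>skew_poly p\<^esub>m\<in>S. single m (d m))"
      using insert by (intro A.finsum_insert) (auto simp: skew_poly_sel)
    then show ?case using insert by (auto simp: skew_poly_sel single_def fun_eq_iff)
  qed
  from this[OF fin] show ?thesis unfolding A.lcomb_def A_smul AQ_tmon single_scale by auto
qed

section \<open>Polynomial extensions\<close>

lemma nc_domain_mult_iff:
  assumes "nc_domain R" "ring R" "x \<in> carrier R" "y \<in> carrier R"
  shows "x \<otimes>\<^bsub>R\<^esub> y = \<zero>\<^bsub>R\<^esub> \<longleftrightarrow> x = \<zero>\<^bsub>R\<^esub> \<or> y = \<zero>\<^bsub>R\<^esub>"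
proof -
  interpret ring R by fact
  show ?thesis using assms unfolding nc_domain_def by auto
qed

context UP_ring
begin

text \<open>The common core of products with a monomial, of leading coefficients and of lowest
  coefficients.\<close>

lemma coeff_mult_one_term:
  assumes [simp]: "x \<in> carrier P" "y \<in> carrier P" and n: "n \<le> N"
    and z: "\<And>i. i \<le> N \<Longrightarrow> i \<noteq> n \<Longrightarrow> up_ring.coeff P x i \<otimes> up_ring.coeff P y (N - i) = \<zero>"
  shows "up_ring.coeff P (x \<otimes>\<^bsub>P\<^esub> y) N = up_ring.coeff P x n \<otimes> up_ring.coeff P y (N - n)"
proof -
  have "up_ring.coeff P (x \<otimes>\<^bsub>P\<^esub> y) N = (\<Oplus>i\<in>{..N}. if n = i then up_ring.coeff P x i \<otimes> up_ring.coeff P y (N - i) else \<zero>)"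
    unfolding coeff_mult[OF assms(1,2)] by (rule R.finsum_cong') (use z in auto)
  also have "\<dots> = up_ring.coeff P x n \<otimes> up_ring.coeff P y (N - n)"
    by (rule R.finsum_singleton) (use n in auto)
  finally show ?thesis .
qed

lemma coeff_mult_zero:
  assumes [simp]: "x \<in> carrier P" "y \<in> carrier P" 
    and z: "\<And>i. i \<le> N \<Longrightarrow> up_ring.coeff P x i \<otimes> up_ring.coeff P y (N - i) = \<zero>"
  shows "up_ring.coeff P (x \<otimes>\<^bsub>P\<^esub> y) N = \<zero>"
  using coeff_mult_one_term[of x y 0 N] z z[of 0] by simp

lemma coeff_mult_monom_right:
  assumes [simp]: "x \<in> carrier P" "b \<in> carrier R"
  shows "up_ring.coeff P (x \<otimes>\<^bsub>P\<^esub> up_ring.monom P b d) N = (if d \<le> N then up_ring.coeff P x (N - d) \<otimes> b else \<zero>)"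
proof (cases "d \<le> N")
  case True
  then show ?thesis by (subst coeff_mult_one_term[of _ _ "N - d"]) auto
qed (auto intro!: coeff_mult_zero simp del: coeff_mult)

lemma coeff_mult_monom_left:
  assumes [simp]: "x \<in> carrier P" "b \<in> carrier R"
  shows "up_ring.coeff P (up_ring.monom P b d \<otimes>\<^bsub>P\<^esub> x) N = (if d \<le> N then b \<otimes> up_ring.coeff P x (N - d) else \<zero>)"
proof (cases "d \<le> N")
  case True
  then show ?thesis by (subst coeff_mult_one_term[of _ _ d]) auto
qed (auto intro!: coeff_mult_zero simp del: coeff_mult)

lemma coeff_mult_top:
  assumes [simp]: "x \<in> carrier P" "y \<in> carrier P"
  shows "up_ring.coeff P (x \<otimes>\<^bsub>P\<^esub> y) (deg R x + deg R y) = up_ring.coeff P x (deg R x) \<otimes> up_ring.coeff P y (deg R y)"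
proof (subst coeff_mult_one_term[of _ _ "deg R x"])
  fix i assume "i \<le> deg R x + deg R y" "i \<noteq> deg R x"
  then have "i > deg R x \<or> deg R x + deg R y - i > deg R y" by linarith
  then show "up_ring.coeff P x i \<otimes> up_ring.coeff P y (deg R x + deg R y - i) = \<zero>"
    using deg_aboveD[of x i] deg_aboveD[of y "deg R x + deg R y - i"] by auto
qed auto

lemma nc_domain_UP:
  assumes "nc_domain R"
  shows "nc_domain P"
  unfolding nc_domain_def
proof (intro conjI ballI impI)
  have "up_ring.coeff P \<one>\<^bsub>P\<^esub> 0 \<noteq> up_ring.coeff P \<zero>\<^bsub>P\<^esub> 0"
    using assms by (simp add: nc_domain_def)
  then show "\<one>\<^bsub>P\<^esub> \<noteq> \<zero>\<^bsub>P\<^esub>" by metis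
  fix x y assume x: "x \<in> carrier P" "y \<in> carrier P" "x \<otimes>\<^bsub>P\<^esub> y = \<zero>\<^bsub>P\<^esub>"
  then have "up_ring.coeff P x (deg R x) \<otimes> up_ring.coeff P y (deg R y) = \<zero>"
    using coeff_mult_top[of x y] by simp
  then show "x = \<zero>\<^bsub>P\<^esub> \<or> y = \<zero>\<^bsub>P\<^esub>"
    using x lcoeff_nonzero nc_domain_mult_iff[OF assms R.ring_axioms] by auto
qed

text \<open>Conjugation by a normal element preserves homogeneity: compare the lowest and the highest
  degrees on both sides.\<close>

lemma normal_homogeneous:
  assumes nc_domain: "nc_domain R" and y: "y \<in> carrier P" "y \<noteq> \<zero>\<^bsub>P\<^esub>" and r: "r \<in> carrier P" and b: "b \<in> carrier R"
    and eq: "y \<otimes>\<^bsub>P\<^esub> up_ring.monom P b d = r \<otimes>\<^bsub>P\<^esub> y"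
  shows "r = up_ring.monom P (up_ring.coeff P r d) d" "up_ring.coeff P y n \<otimes> b = up_ring.coeff P r d \<otimes> up_ring.coeff P y n"
proof -
  note integral = nc_domain_mult_iff[OF nc_domain R.ring_axioms]
  \<comment> \<open>Every degree that occurs in \<open>r \<otimes> y\<close> is \<open>d\<close>
    plus a degree that occurs in \<open>y\<close>. A term of \<open>r\<close> of degree above
    \<open>d\<close> violates this at the top, one of degree below \<open>d\<close> at the
    bottom.\<close>
  have supp: "\<exists>m\<le>N. N - m = d \<and> up_ring.coeff P y m \<noteq> \<zero>" if "up_ring.coeff P (r \<otimes>\<^bsub>P\<^esub> y) N \<noteq> \<zero>" for N
    using that b y unfolding eq[symmetric] coeff_mult_monom_right[OF y(1) b]
    by (intro exI[of _ "N - d"]) (auto split: if_splits)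
  have r0: "up_ring.coeff P r i = \<zero>" if i: "i \<noteq> d" for i
  proof (rule ccontr)
    assume ri: "up_ring.coeff P r i \<noteq> \<zero>"
    show False
    proof (cases "i > d")
      case True
      have rn: "r \<noteq> \<zero>\<^bsub>P\<^esub>" using ri by auto
      have "up_ring.coeff P (r \<otimes>\<^bsub>P\<^esub> y) (deg R r + deg R y) \<noteq> \<zero>"
        using coeff_mult_top[OF r y(1)] lcoeff_nonzero[OF rn r] lcoeff_nonzero[OF y(2,1)] integral r y(1) by simp
      then obtain m where "m \<le> deg R r + deg R y" "deg R r + deg R y - m = d" "up_ring.coeff P y m \<noteq> \<zero>"
        using supp by blast
      moreover have "deg R r \<ge> i" using ri r by (intro deg_belowI)
      moreover have "m \<le> deg R y" by (rule deg_belowI) (use calculation y in auto)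
      ultimately show False using True by linarith
    next
      case False
      obtain l where l: "up_ring.coeff P r l \<noteq> \<zero>" "\<And>j. j < l \<Longrightarrow> up_ring.coeff P r j = \<zero>"
        using exists_least_iff[of "\<lambda>i. up_ring.coeff P r i \<noteq> \<zero>"] ri by blast
      then have li: "l \<le> i" using ri by (meson not_le)
      obtain m where m: "up_ring.coeff P y m \<noteq> \<zero>" "\<And>j. j < m \<Longrightarrow> up_ring.coeff P y j = \<zero>"
        using exists_least_iff[of "\<lambda>i. up_ring.coeff P y i \<noteq> \<zero>"] lcoeff_nonzero[OF y(2,1)] by blast
      have "up_ring.coeff P (r \<otimes>\<^bsub>P\<^esub> y) (l + m) = up_ring.coeff P r l \<otimes> up_ring.coeff P y (l + m - l)"
      proof (rule coeff_mult_one_term)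
        fix j assume "j \<le> l + m" "j \<noteq> l"
        then have "j < l \<or> l + m - j < m" by linarith
        then show "up_ring.coeff P r j \<otimes> up_ring.coeff P y (l + m - j) = \<zero>" using l(2) m(2) r y by auto
      qed (use r y in auto)
      also have "\<dots> \<noteq> \<zero>" using l m integral r y by simp
      finally obtain n where "n \<le> l + m" "l + m - n = d" "up_ring.coeff P y n \<noteq> \<zero>" using supp by blast
      moreover have "m \<le> n" using m(2) calculation(3) by (meson not_le)
      ultimately show False using li False i by linarith
    qed
  qed
  show r_eq: "r = up_ring.monom P (up_ring.coeff P r d) d"
    by (rule up_eqI) (use r0 r in auto)
  have "up_ring.coeff P y n \<otimes> b = up_ring.coeff P (y \<otimes>\<^bsub>P\<^esub> up_ring.monom P b d) (n + d)"
    using coeff_mult_monom_right[OF y(1) b] by simp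
  also have "\<dots> = up_ring.coeff P (up_ring.monom P (up_ring.coeff P r d) d \<otimes>\<^bsub>P\<^esub> y) (n + d)"
    using eq r_eq by simp
  also have "\<dots> = up_ring.coeff P r d \<otimes> up_ring.coeff P y n"
    using coeff_mult_monom_left[OF y(1), of "up_ring.coeff P r d" d "n + d"] r by simp
  finally show "up_ring.coeff P y n \<otimes> b = up_ring.coeff P r d \<otimes> up_ring.coeff P y n" .
qed

end

section \<open>Scalars and spans in the polynomial extension\<close>

context kalg
begin

sublocale U: UP_ring R "UP R"
  by (simp add: UP_ring_def local.ring_axioms)

lemma poly_unit_monom: "poly_unit R eta c = up_ring.monom (UP R) (eta c) 0"
  by (simp add: UP_def poly_unit_def fun_eq_iff)

lemma kalg_UP: "kalg (UP R) (poly_unit R eta)"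
proof (intro kalg.intro kalg_axioms.intro U.UP_ring)
  show "poly_unit R eta (a * b) = poly_unit R eta a \<otimes>\<^bsub>UP R\<^esub> poly_unit R eta b" for a b
    using U.monom_mult[of "eta a" "eta b" 0 0] by (simp add: poly_unit_monom eta_mult)
  show "poly_unit R eta c \<otimes>\<^bsub>UP R\<^esub> x = x \<otimes>\<^bsub>UP R\<^esub> poly_unit R eta c"
    if "x \<in> carrier (UP R)" for x c
    by (rule U.up_eqI) (use that in \<open>auto simp: poly_unit_monom U.coeff_mult_monom_left 
      U.coeff_mult_monom_right eta_central simp del: U.coeff_mult\<close>)
qed (auto simp: poly_unit_monom eta_add)

interpretation UK: kalg "UP R" "poly_unit R eta"
  by (rule kalg_UP)

lemma coeff_smul:
  "x \<in> carrier (UP R) \<Longrightarrow> up_ring.coeff (UP R) (UK.smul c x) n = c \<star> up_ring.coeff (UP R) x n"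
  by (simp add: UK.smul_def smul_def poly_unit_monom U.coeff_mult_monom_left del: U.coeff_mult)

lemma monom_smul: "x \<in> carrier R \<Longrightarrow> up_ring.monom (UP R) (c \<star> x) n = UK.smul c (up_ring.monom (UP R) x n)"
  by (rule U.up_eqI) (auto simp: coeff_smul)

lemma monom_lspan: "x \<in> lspan S \<Longrightarrow> (\<And>s. s \<in> S \<Longrightarrow> s \<in> carrier R \<Longrightarrow> up_ring.monom (UP R) s n \<in> UK.lspan T)
   \<Longrightarrow> up_ring.monom (UP R) x n \<in> UK.lspan T"
  by (induction rule: lspan.induct) (auto simp: monom_smul lspan_carrier UK.lspan_add UK.lspan_smul)

lemma monom_lspan_UP: 
  assumes "\<And>b n. b \<in> carrier R \<Longrightarrow> up_ring.monom (UP R) b n \<in> UK.lspan T" "x \<in> carrier (UP R)"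
  shows "x \<in> UK.lspan T"
  by (subst U.up_repr[OF assms(2), symmetric]) (rule UK.lspan_finsum; use assms in simp)

lemma coeff_lspan: 
  assumes "x \<in> UK.lspan S" "\<And>s. s \<in> S \<Longrightarrow> s \<in> carrier (UP R) \<Longrightarrow> up_ring.coeff (UP R) s n \<in> lspan T"
  shows "up_ring.coeff (UP R) x n \<in> lspan T"
  using assms
  by (induction rule: UK.lspan.induct) 
    (auto simp: UK.lspan_carrier coeff_smul lspan_add lspan_smul)

end

section \<open>Monomials in the polynomial extension\<close>

context qtriple
begin

interpretation UK: kalg "UP R" "poly_unit R eta"
  by (rule kalg_UP)

lemma qquad_UP: "qquad (UP R) (poly_unit R eta) p 
  (up_ring.monom (UP R) u1 0) (up_ring.monom (UP R) u2 0) (up_ring.monom (UP R) u3 0) (up_ring.monom (UP R) \<one> 1)"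
proof unfold_locales
  note m = U.monom_mult[of _ _ 0 0, simplified, symmetric]
  show "up_ring.monom (UP R) u2 0 \<otimes>\<^bsub>UP R\<^esub> up_ring.monom (UP R) u1 0 = UK.smul (p 1 2) (up_ring.monom (UP R) u1 0 \<otimes>\<^bsub>UP R\<^esub> up_ring.monom (UP R) u2 0)"
    using m[of u2 u1] m[of u1 u2] u21 by (simp add: monom_smul del: U.monom_mult)
  show "up_ring.monom (UP R) u3 0 \<otimes>\<^bsub>UP R\<^esub> up_ring.monom (UP R) u1 0 = UK.smul (p 1 3) (up_ring.monom (UP R) u1 0 \<otimes>\<^bsub>UP R\<^esub> up_ring.monom (UP R) u3 0)"
    using m[of u3 u1] m[of u1 u3] u31 by (simp add: monom_smul del: U.monom_mult)
  show "up_ring.monom (UP R) u3 0 \<otimes>\<^bsub>UP R\<^esub> up_ring.monom (UP R) u2 0 = UK.smul (p 2 3) (up_ring.monom (UP R) u2 0 \<otimes>\<^bsub>UP R\<^esub> up_ring.monom (UP R) u3 0)"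
    using m[of u3 u2] m[of u2 u3] u32 by (simp add: monom_smul del: U.monom_mult)
  show "up_ring.monom (UP R) \<one> 1 \<otimes>\<^bsub>UP R\<^esub> x = x \<otimes>\<^bsub>UP R\<^esub> up_ring.monom (UP R) \<one> 1" if "x \<in> carrier (UP R)" for x
    by (rule U.up_eqI) (use that in \<open>auto simp: U.coeff_mult_monom_left 
      U.coeff_mult_monom_right simp del: U.coeff_mult\<close>)
qed simp_all

interpretation UQ: qquad "UP R" "poly_unit R eta" p 
  "up_ring.monom (UP R) u1 0" "up_ring.monom (UP R) u2 0" "up_ring.monom (UP R) u3 0" "up_ring.monom (UP R) \<one> 1"
  by (rule qquad_UP)

lemma monom_pow_const: "x \<in> carrier R \<Longrightarrow> up_ring.monom (UP R) x 0 [^]\<^bsub>UP R\<^esub> (n::nat) = up_ring.monom (UP R) (x [^] n) 0"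
  by (induction n) (use U.monom_mult[of _ _ 0 0] in simp_all)

lemma monom_pow_var: "up_ring.monom (UP R) \<one> 1 [^]\<^bsub>UP R\<^esub> (n::nat) = up_ring.monom (UP R) \<one> n"
proof (induction n)
  case (Suc n)
  then show ?case using U.monom_mult[of \<one> \<one> n 1] by simp
qed simp

lemma UQ_qmon: "UQ.qmon (m, n) = up_ring.monom (UP R) (tmon m) n"
proof -
  obtain a b c where m: "m = (a, b, c)" by (cases m)
  have "UQ.tmon m = up_ring.monom (UP R) (tmon m) 0"
    unfolding m UQ.tmon.simps tmon.simps
    using U.monom_mult[of _ _ 0 0] by (simp add: monom_pow_const)
  then show ?thesis using U.monom_mult[of "tmon m" \<one> 0 n] by (simp add: monom_pow_var del: One_nat_def)
qed

lemma UQ_full: "lspan (range tmon) = carrier R \<Longrightarrow> UK.lspan (range UQ.qmon) = carrier (UP R)"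
proof -
  assume full: "lspan (range tmon) = carrier R"
  have "up_ring.monom (UP R) b n \<in> UK.lspan (range UQ.qmon)" if "b \<in> carrier R" for b n
  proof (rule monom_lspan[where S = "range tmon"])
    show "up_ring.monom (UP R) s n \<in> UK.lspan (range UQ.qmon)" if s: "s \<in> range tmon" for s
    proof -
      obtain m where "s = tmon m" using s by blast
      then show ?thesis
        using UK.lspan_base[of "UQ.qmon (m, n)" "range UQ.qmon"] UQ_qmon[of m n] by (metis UQ.qmon_closed rangeI)
    qed
  qed (use that full in auto)
  then show ?thesis using monom_lspan_UP UK.lspan_carrier by blast
qed

lemma UQ_lcomb_coeff:
  assumes d: "finite {x. d x \<noteq> 0}"
  shows "up_ring.coeff (UP R) (UK.lcomb UQ.qmon d) n = lcomb tmon (\<lambda>m. d (m, n))"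
proof -
  let ?D = "{x. d x \<noteq> 0}" and ?E = "{m. d (m, n) \<noteq> 0}"
  have finE: "finite ?E" using finite_imageI[OF d, of fst] by (rule finite_subset[rotated]) force
  have "up_ring.coeff (UP R) (UK.lcomb UQ.qmon d) n = 
      (\<Oplus>x\<in>?D. up_ring.coeff (UP R) (UK.smul (d x) (UQ.qmon x)) n)"
    unfolding UK.lcomb_def by (rule U.coeff_finsum[OF d]) (intro Pi_I UK.smul_closed UQ.qmon_closed)
  also have "\<dots> = (\<Oplus>x\<in>?D. if snd x = n then d x \<star> tmon (fst x) else \<zero>)"
  proof (rule finsum_cong')
    fix x assume "x \<in> ?D"
    obtain m k where x: "x = (m, k)" by (cases x)
    show "up_ring.coeff (UP R) (UK.smul (d x) (UQ.qmon x)) n = (if snd x = n then d x \<star> tmon (fst x) else \<zero>)"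
      unfolding x UQ_qmon by (simp add: coeff_smul)
  qed auto
  also have "\<dots> = (\<Oplus>x\<in>(\<lambda>m. (m, n)) ` ?E. d x \<star> tmon (fst x))"
    by (rule add.finprod_mono_neutral_cong_right) (use d in auto)
  also have "\<dots> = (\<Oplus>m\<in>?E. d (m, n) \<star> tmon m)"
    by (subst finsum_reindex) (auto simp: inj_on_def)
  finally show ?thesis unfolding lcomb_def .
qed

text \<open>From right to left this carries the PBW basis of \<open>A\<close> to
  \<open>A[t]\<close>; from left to right it brings independence down from \<open>B[t]\<close> to
  \<open>B\<close>. The n-th coefficient collects the exponents whose last entry is n.\<close>

lemma UQ_indep_iff: "UK.indep UQ.qmon \<longleftrightarrow> indep tmon"
proof
  assume ind: "indep tmon"
  show "UK.indep UQ.qmon" unfolding UK.indep_def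
  proof (intro allI impI)
    fix d and x :: "(nat \<times> nat \<times> nat) \<times> nat"
    assume d: "finite {x. d x \<noteq> 0}" "UK.lcomb UQ.qmon d = \<zero>\<^bsub>UP R\<^esub>"
    obtain m n where x: "x = (m, n)" by (cases x)
    have "finite {m. d (m, n) \<noteq> 0}" 
      using finite_imageI[OF d(1), of fst] by (rule finite_subset[rotated]) force
    moreover have "lcomb tmon (\<lambda>m. d (m, n)) = \<zero>"
      using UQ_lcomb_coeff[OF d(1), of n] d(2) by simp
    ultimately show "d x = 0" unfolding x using indepD[OF ind, of "\<lambda>m. d (m, n)"] by blast
  qed
next
  assume ind: "UK.indep UQ.qmon"
  show "indep tmon" unfolding indep_def
  proof (intro allI impI)
    fix d m assume d: "finite {m. d m \<noteq> 0}" "lcomb tmon d = \<zero>"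
    define d' where "d' x = (if snd x = (0::nat) then d (fst x) else 0)" for x
    have "{x. d' x \<noteq> 0} \<subseteq> {m. d m \<noteq> 0} \<times> {0}" by (auto simp: d'_def split: if_splits)
    then have fin: "finite {x. d' x \<noteq> 0}" by (rule finite_subset) (use d in auto)
    have "UK.lcomb UQ.qmon d' = \<zero>\<^bsub>UP R\<^esub>"
    proof (rule U.up_eqI)
      fix n
      show "up_ring.coeff (UP R) (UK.lcomb UQ.qmon d') n = up_ring.coeff (UP R) \<zero>\<^bsub>UP R\<^esub> n"
        unfolding UQ_lcomb_coeff[OF fin] using d by (cases "n = 0") (simp_all add: d'_def lcomb_zero)
    qed (intro UK.lcomb_closed UQ.qmon_range, simp)
    then have "d' (m, 0) = 0" using UK.indepD[OF ind fin] by blast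
    then show "d m = 0" by (simp add: d'_def)
  qed
qed

end

section \<open>Graded domains\<close>

text \<open>The domain property is not an assumption on \<open>B\<close>: it is inherited from
  \<open>A[t]\<close> through \<open>B[t]\<close>.\<close>

locale graded_kalg = kalg R eta for R (structure) and eta :: "'k::field \<Rightarrow> 'a" +
  fixes G :: "nat \<Rightarrow> 'a set"
  assumes graded: "conn_graded R eta G"
    and nc_domain: "nc_domain R"
begin

lemma G_carrier: "x \<in> G n \<Longrightarrow> x \<in> carrier R"
  and G_zero [simp]: "\<zero> \<in> G n"
  and G_add: "\<lbrakk>x \<in> G n; y \<in> G n\<rbrakk> \<Longrightarrow> x \<oplus> y \<in> G n"
  and G_mult: "\<lbrakk>x \<in> G m; y \<in> G n\<rbrakk> \<Longrightarrow> x \<otimes> y \<in> G (m + n)"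
  and G_0: "G 0 = range eta"
proof -
  have "G n \<subseteq> carrier R \<and> \<zero> \<in> G n \<and> (\<forall>x\<in>G n. \<forall>y\<in>G n. x \<oplus> y \<in> G n)" for n
    using graded unfolding conn_graded_def by (elim conjE) (erule allE[of _ n], iprover)
  then show "x \<in> G n \<Longrightarrow> x \<in> carrier R" "\<zero> \<in> G n" "\<lbrakk>x \<in> G n; y \<in> G n\<rbrakk> \<Longrightarrow> x \<oplus> y \<in> G n"
    by (meson subsetD)+
  show "\<lbrakk>x \<in> G m; y \<in> G n\<rbrakk> \<Longrightarrow> x \<otimes> y \<in> G (m + n)" "G 0 = range eta"
    using graded unfolding conn_graded_def by simp_all
qed

lemmas integral = nc_domain_mult_iff[OF nc_domain ring_axioms]

lemma one_neq_zero: "\<one> \<noteq> \<zero>"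
  using nc_domain by (simp add: nc_domain_def)

lemma cancel_right:
  assumes "x \<otimes> y = x' \<otimes> y" "x \<in> carrier R" "x' \<in> carrier R" "y \<in> carrier R" "y \<noteq> \<zero>"
  shows "x = x'"
proof -
  have "(x \<ominus> x') \<otimes> y = \<zero>" using assms by (simp add: a_minus_def l_distr l_minus r_neg)
  then show ?thesis using assms integral by simp
qed

definition hcomp :: "'a \<Rightarrow> nat \<Rightarrow> 'a"
  where "hcomp b = (THE f. (\<forall>n. f n \<in> G n) \<and> finite {n. f n \<noteq> \<zero>} \<and> b = finsum R f {n. f n \<noteq> \<zero>})"

lemma hcomp_ex1:
  "b \<in> carrier R \<Longrightarrow> \<exists>!f. (\<forall>n. f n \<in> G n) \<and> finite {n. f n \<noteq> \<zero>} \<and> b = finsum R f {n. f n \<noteq> \<zero>}"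
  using graded unfolding conn_graded_def by (elim conjE) (erule bspec)

lemma hcomp_spec:
  assumes "b \<in> carrier R"
  shows "hcomp b n \<in> G n" "finite {n. hcomp b n \<noteq> \<zero>}" "finsum R (hcomp b) {n. hcomp b n \<noteq> \<zero>} = b"
  using theI'[OF hcomp_ex1[OF assms], folded hcomp_def] by auto

lemma hcomp_closed [simp, intro]: "b \<in> carrier R \<Longrightarrow> hcomp b n \<in> carrier R"
  using hcomp_spec(1) G_carrier by blast

lemma hcomp_unique:
  assumes f: "\<And>n. f n \<in> G n" and S: "finite S" "{n. f n \<noteq> \<zero>} \<subseteq> S" and b: "b = finsum R f S"
  shows "hcomp b = f"
proof -
  have fR: "f n \<in> carrier R" for n using f G_carrier by blast
  have "finsum R f {n. f n \<noteq> \<zero>} = finsum R f S"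
    by (rule add.finprod_mono_neutral_cong_left) (use S fR in auto)
  then have f': "(\<forall>n. f n \<in> G n) \<and> finite {n. f n \<noteq> \<zero>} \<and> b = finsum R f {n. f n \<noteq> \<zero>}"
    using assms finite_subset by auto
  have "b \<in> carrier R" unfolding b by (rule finsum_closed) (use fR in auto)
  then show ?thesis
    unfolding hcomp_def by (intro the1_equality hcomp_ex1 f')
qed

lemma hcomp_superset:
  assumes b: "b \<in> carrier R" and "finite S" "{n. hcomp b n \<noteq> \<zero>} \<subseteq> S"
  shows "finsum R (hcomp b) S = b"
proof -
  have "finsum R (hcomp b) {n. hcomp b n \<noteq> \<zero>} = finsum R (hcomp b) S"
    by (rule add.finprod_mono_neutral_cong_left) (use assms in auto)
  then show ?thesis using hcomp_spec(3)[OF b] by simp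
qed

lemma hcomp_add:
  assumes "a \<in> carrier R" "b \<in> carrier R"
  shows "hcomp (a \<oplus> b) = (\<lambda>n. hcomp a n \<oplus> hcomp b n)"
proof (rule hcomp_unique)
  let ?S = "{n. hcomp a n \<noteq> \<zero>} \<union> {n. hcomp b n \<noteq> \<zero>}"
  show "finite ?S" using hcomp_spec(2) assms by simp
  then have "finsum R (\<lambda>n. hcomp a n \<oplus> hcomp b n) ?S = finsum R (hcomp a) ?S \<oplus> finsum R (hcomp b) ?S"
    by (intro finsum_addf) (use assms in auto)
  then show "a \<oplus> b = finsum R (\<lambda>n. hcomp a n \<oplus> hcomp b n) ?S"
    using hcomp_superset[OF assms(1) \<open>finite ?S\<close>] hcomp_superset[OF assms(2) \<open>finite ?S\<close>] by auto
qed (use assms hcomp_spec(1) G_add in auto)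

lemma hcomp_homog: 
  assumes "b \<in> G d" 
  shows "hcomp b = (\<lambda>n. if n = d then b else \<zero>)"
proof (rule hcomp_unique[where S = "{d}"])
  show "b = finsum R (\<lambda>n. if n = d then b else \<zero>) {d}"
    using finsum_singleton[of d "{d}" "\<lambda>_. b"] assms G_carrier by (simp add: eq_commute cong: if_cong)
qed (use assms in auto)

lemma hcomp_zero: "hcomp \<zero> n = \<zero>"
  using hcomp_homog[of \<zero> 0] by simp

lemma hcomp_one: "hcomp \<one> = (\<lambda>n. if n = 0 then \<one> else \<zero>)"
  by (rule hcomp_homog) (metis G_0 eta_1 rangeI)

lemma homog_hcomp: "\<lbrakk>b \<in> carrier R; \<And>n. n \<noteq> d \<Longrightarrow> hcomp b n = \<zero>\<rbrakk> \<Longrightarrow> b = hcomp b d"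
  using hcomp_superset[of b "{d}"] by (cases "hcomp b d = \<zero>") force+

lemma graded_induct [consumes 1, case_names zero add]:
  assumes x: "x \<in> carrier R" and z: "P \<zero>"
    and add: "\<And>g d x. \<lbrakk>g \<in> G d; x \<in> carrier R; P x\<rbrakk> \<Longrightarrow> P (g \<oplus> x)"
  shows "P x"
proof -
  have "finite S \<Longrightarrow> P (finsum R (hcomp x) S)" for S
  proof (induction rule: finite_induct)
    case (insert n S)
    have "finsum R (hcomp x) (insert n S) = hcomp x n \<oplus> finsum R (hcomp x) S"
      by (rule finsum_insert) (use insert x in auto)
    moreover have "finsum R (hcomp x) S \<in> carrier R" by (rule finsum_closed) (use x in auto)
    ultimately show ?case using add[OF hcomp_spec(1)[OF x]] insert by metis
  qed (simp add: z)
  from this[OF hcomp_spec(2)[OF x]] show ?thesis using hcomp_spec(3)[OF x] by simp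
qed

text \<open>Elements of \<open>UP R\<close> are coefficient functions, so the family of components
  of \<open>b\<close> is already a polynomial; its exponent records the degree in the
  grading.\<close>

lemma hcomp_UP [simp]: "b \<in> carrier R \<Longrightarrow> hcomp b \<in> carrier (UP R)"
proof -
  assume b: "b \<in> carrier R"
  obtain n where "\<forall>i\<in>{n. hcomp b n \<noteq> \<zero>}. i \<le> n"
    using hcomp_spec(2)[OF b] finite_nat_set_iff_bounded_le by blast
  then have "bound \<zero> n (hcomp b)" by (intro bound.intro) force
  then show ?thesis using b by (auto simp: UP_def)
qed

lemma coeff_hcomp: "b \<in> carrier R \<Longrightarrow> up_ring.coeff (UP R) (hcomp b) n = hcomp b n"
  using hcomp_UP by (simp add: UP_def)

text \<open>The grading as a coaction: \<open>hcomp\<close> is a ring homomorphism into the polynomials.\<close>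

lemma hcomp_add_UP: 
  "\<lbrakk>a \<in> carrier R; b \<in> carrier R\<rbrakk> \<Longrightarrow> hcomp (a \<oplus> b) = hcomp a \<oplus>\<^bsub>UP R\<^esub> hcomp b"
  by (rule U.up_eqI) (simp_all add: coeff_hcomp hcomp_add[THEN fun_cong])

lemma hcomp_homog_UP: "b \<in> G d \<Longrightarrow> hcomp b = up_ring.monom (UP R) b d"
  using G_carrier[of b d] by (simp add: hcomp_homog UP_def)

text \<open>Through this homomorphism, statements about degrees in a polynomial ring, above all
  \<open>normal_homogeneous\<close>, apply to the grading of \<open>R\<close> itself. Additivity
  reduces the proof to homogeneous factors.\<close>

lemma hcomp_mult_UP:
  assumes "a \<in> carrier R" "b \<in> carrier R"
  shows "hcomp (a \<otimes> b) = hcomp a \<otimes>\<^bsub>UP R\<^esub> hcomp b"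
proof -
  have *: "hcomp (g \<otimes> b) = up_ring.monom (UP R) g d \<otimes>\<^bsub>UP R\<^esub> hcomp b" if g: "g \<in> G d" for g d
    using assms(2)
  proof (induction rule: graded_induct)
    case zero
    have "up_ring.monom (UP R) \<zero> 0 = \<zero>\<^bsub>UP R\<^esub>" by (rule U.monom_zero)
    then show ?case using hcomp_homog_UP[of \<zero> 0] g G_carrier by simp
  next
    case (add h e x)
    note [simp] = G_carrier[OF g] G_carrier[OF add(1)] add(2)
    have "hcomp (g \<otimes> h) = up_ring.monom (UP R) g d \<otimes>\<^bsub>UP R\<^esub> hcomp h"
      using hcomp_homog_UP[OF G_mult[OF g add(1)]] hcomp_homog_UP[OF add(1)] by simp
    then show ?case
      using add by (simp add: r_distr hcomp_add_UP U.r_distr)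
  qed
  show ?thesis using assms(1)
  proof (induction rule: graded_induct)
    case zero
    have "up_ring.monom (UP R) \<zero> 0 = \<zero>\<^bsub>UP R\<^esub>" by (rule U.monom_zero)
    then show ?case using hcomp_homog_UP[of \<zero> 0] assms(2) by simp
  next
    case (add g d x)
    note [simp] = G_carrier[OF add(1)] add(2) assms(2)
    show ?case using add *[OF add(1)] hcomp_homog_UP[OF add(1)]
      by (simp add: l_distr hcomp_add_UP U.l_distr)
  qed
qed

lemma hcomp_mult_homog_right:
  "\<lbrakk>a \<in> carrier R; b \<in> G d\<rbrakk> \<Longrightarrow> hcomp (a \<otimes> b) (n + d) = hcomp a n \<otimes> b"
  using coeff_hcomp[of "a \<otimes> b" "n + d"] U.coeff_mult_monom_right[of "hcomp a" b d "n + d"]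
  by (simp add: hcomp_mult_UP hcomp_homog_UP G_carrier coeff_hcomp del: U.coeff_mult)

lemma hcomp_mult_homog_left:
  "\<lbrakk>a \<in> carrier R; b \<in> G d\<rbrakk> \<Longrightarrow> hcomp (b \<otimes> a) (n + d) = b \<otimes> hcomp a n"
  using coeff_hcomp[of "b \<otimes> a" "n + d"] U.coeff_mult_monom_left[of "hcomp a" b d "n + d"]
  by (simp add: hcomp_mult_UP hcomp_homog_UP G_carrier coeff_hcomp del: U.coeff_mult)

lemma hcomp_mult_0:
  "\<lbrakk>a \<in> carrier R; b \<in> carrier R\<rbrakk> \<Longrightarrow> hcomp (a \<otimes> b) 0 = hcomp a 0 \<otimes> hcomp b 0"
  using coeff_hcomp[of "a \<otimes> b" 0] by (simp add: hcomp_mult_UP coeff_hcomp)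

lemma hcomp_smul: "a \<in> carrier R \<Longrightarrow> hcomp (c \<star> a) n = c \<star> hcomp a n"
  using hcomp_mult_homog_left[of a "eta c" 0 n] by (simp add: smul_def G_0)

lemma eta_eq_0_iff [simp]: "eta c = \<zero> \<longleftrightarrow> c = 0"
  using smul_eq_zero[of \<one> c] one_neq_zero by (auto simp: smul_one)

lemma eta_inj: "eta c = eta d \<longleftrightarrow> c = d"
proof
  assume "eta c = eta d"
  then have "eta c \<oplus> eta (- d) = \<zero>" using eta_add[of d "-d"] by simp
  then have "eta (c + - d) = \<zero>" unfolding eta_add .
  then show "c = d" by simp
qed simp

text \<open>The augmentation of \<open>R\<close>. Connectedness makes the component of degree 0 a
  scalar, and injectivity of \<open>eta\<close> makes that scalar unique.\<close>

definition eps :: "'a \<Rightarrow> 'k"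
  where "eps b = (THE c. eta c = hcomp b 0)"

lemma eta_eps: "b \<in> carrier R \<Longrightarrow> eta (eps b) = hcomp b 0"
proof -
  assume "b \<in> carrier R"
  then have "hcomp b 0 \<in> range eta" using hcomp_spec(1)[of b 0] G_0 by simp
  then obtain c where "eta c = hcomp b 0" by auto
  then have "\<exists>!c. eta c = hcomp b 0" using eta_inj by metis
  then show ?thesis unfolding eps_def by (rule theI')
qed

lemma eps_eq_0_iff: "b \<in> carrier R \<Longrightarrow> eps b = 0 \<longleftrightarrow> hcomp b 0 = \<zero>"
  using eta_eps eta_eq_0_iff by metis

lemma eps_unique: "\<lbrakk>b \<in> carrier R; hcomp b 0 = eta c\<rbrakk> \<Longrightarrow> eps b = c"
  using eta_eps eta_inj by metis

lemma eps_add: "\<lbrakk>a \<in> carrier R; b \<in> carrier R\<rbrakk> \<Longrightarrow> eps (a \<oplus> b) = eps a + eps b"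
  by (rule eps_unique) (simp_all add: hcomp_add eta_add eta_eps)

lemma eps_mult: "\<lbrakk>a \<in> carrier R; b \<in> carrier R\<rbrakk> \<Longrightarrow> eps (a \<otimes> b) = eps a * eps b"
  by (rule eps_unique) (simp_all add: hcomp_mult_0 eta_mult eta_eps)

lemma eps_smul: "a \<in> carrier R \<Longrightarrow> eps (c \<star> a) = c * eps a"
  by (rule eps_unique) (simp_all add: hcomp_smul eta_mult eta_eps, simp add: smul_def)

lemma eps_zero [simp]: "eps \<zero> = 0"
  by (simp add: eps_eq_0_iff hcomp_zero)

lemma eps_one [simp]: "eps \<one> = 1"
  by (rule eps_unique) (simp_all add: hcomp_one)

interpretation UK: kalg "UP R" "poly_unit R eta"
  by (rule kalg_UP)

text \<open>Conjugation by a normal element of \<open>B[t]\<close> is a graded automorphism, so all its bihomogeneous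
  components induce the same automorphism.\<close>

lemma normal_components:
  assumes y: "y \<in> carrier (UP R)" "y \<noteq> \<zero>\<^bsub>UP R\<^esub>"
    and normal: "\<And>r. r \<in> carrier (UP R) \<Longrightarrow> \<exists>r'\<in>carrier (UP R). y \<otimes>\<^bsub>UP R\<^esub> r = r' \<otimes>\<^bsub>UP R\<^esub> y"
    and z: "z \<in> carrier (UP R)" and yz: "y \<otimes>\<^bsub>UP R\<^esub> z = UK.smul q (z \<otimes>\<^bsub>UP R\<^esub> y)"
  shows "hcomp (up_ring.coeff (UP R) y n) w \<otimes> hcomp (up_ring.coeff (UP R) z m) v =
    q \<star> (hcomp (up_ring.coeff (UP R) z m) v \<otimes> hcomp (up_ring.coeff (UP R) y n) w)"
proof -
  let ?y = "up_ring.coeff (UP R) y" and ?z = "up_ring.coeff (UP R) z"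
  have yR [simp]: "?y n \<in> carrier R" and zR [simp]: "?z n \<in> carrier R" for n
    using y z by simp_all
  \<comment> \<open>Conjugation preserves the degree in the variable, so a constant goes to a
    constant, and the same \<open>b'\<close> serves all coefficients of \<open>y\<close>. This
    defines the automorphism \<open>s\<close>.\<close>
  have "\<exists>b'\<in>carrier R. \<forall>n. ?y n \<otimes> b = b' \<otimes> ?y n" if b: "b \<in> carrier R" for b
  proof -
    obtain r where r: "r \<in> carrier (UP R)" "y \<otimes>\<^bsub>UP R\<^esub> up_ring.monom (UP R) b 0 = r \<otimes>\<^bsub>UP R\<^esub> y"
      using normal[of "up_ring.monom (UP R) b 0"] b by auto
    then show ?thesis using U.normal_homogeneous(2)[OF nc_domain y r(1) b r(2)] by auto
  qed
  then obtain s where s: "\<And>b. b \<in> carrier R \<Longrightarrow> s b \<in> carrier R"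
    "\<And>b n. b \<in> carrier R \<Longrightarrow> ?y n \<otimes> b = s b \<otimes> ?y n" by metis
  define n0 where "n0 = deg R y"
  have n0: "?y n0 \<noteq> \<zero>" unfolding n0_def by (rule U.lcoeff_nonzero[OF y(2,1)])
  have c0: "hcomp (?y n0) \<noteq> \<zero>\<^bsub>UP R\<^esub>"
  proof
    assume "hcomp (?y n0) = \<zero>\<^bsub>UP R\<^esub>"
    then have "hcomp (?y n0) i = \<zero>" for i using coeff_hcomp[OF yR, of n0 i] by simp
    then show False using homog_hcomp[of "?y n0" 0] n0 by simp
  qed
  \<comment> \<open>The comparison of degrees is repeated for the grading:
    \<open>normal_homogeneous\<close> is applied to the polynomial formed by the components of the
    nonzero coefficient \<open>?y n0\<close>.\<close>
  have sG: "s b \<in> G d" if b: "b \<in> G d" for b d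
  proof -
    have bR [simp]: "b \<in> carrier R" using b G_carrier by blast
    have "hcomp (?y n0) \<otimes>\<^bsub>UP R\<^esub> up_ring.monom (UP R) b d = hcomp (s b) \<otimes>\<^bsub>UP R\<^esub> hcomp (?y n0)"
      using s[OF bR] hcomp_mult_UP[of "?y n0" b] hcomp_mult_UP[of "s b" "?y n0"] hcomp_homog_UP[OF b] by simp
    then have "hcomp (s b) = up_ring.monom (UP R) (up_ring.coeff (UP R) (hcomp (s b)) d) d"
      using s(1)[OF bR] by (intro U.normal_homogeneous(1)[OF nc_domain _ c0]) auto
    then have "up_ring.coeff (UP R) (hcomp (s b)) n = \<zero>" if "n \<noteq> d" for n
      using that s(1)[OF bR] U.coeff_monom[of "up_ring.coeff (UP R) (hcomp (s b)) d" d n] by simp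
    then have "s b = hcomp (s b) d" using s(1)[OF bR] coeff_hcomp by (intro homog_hcomp) auto
    then show ?thesis using hcomp_spec(1)[OF s(1)[OF bR], of d] by simp
  qed
  have hcomp_s: "hcomp (?y n) w \<otimes> b = s b \<otimes> hcomp (?y n) w" if b: "b \<in> G d" for b d n w
    using hcomp_mult_homog_right[OF yR b, of n w] hcomp_mult_homog_left[OF yR sG[OF b], of n w]
      s(2)[of b n] G_carrier[OF b] by simp
  \<comment> \<open>Applying \<open>s\<close> to all coefficients of \<open>z\<close> gives
    \<open>r\<close> with \<open>y \<otimes> z = r \<otimes> y\<close>; cancelling \<open>y\<close>
    against the given relation leaves \<open>r = q z\<close>.\<close>
  have sz: "s (?z m) = q \<star> ?z m"
  proof -
    let ?D = "{..max m (deg R z)}"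
    have zrep: "z = (\<Oplus>\<^bsub>UP R\<^esub>i\<in>?D. up_ring.monom (UP R) (?z i) i)"
      using U.up_repr_le[OF _ z] by simp
    define r where "r = (\<Oplus>\<^bsub>UP R\<^esub>i\<in>?D. up_ring.monom (UP R) (s (?z i)) i)"
    have rR: "r \<in> carrier (UP R)" unfolding r_def by (rule U.finsum_closed) (use s in auto)
    have "y \<otimes>\<^bsub>UP R\<^esub> z = (\<Oplus>\<^bsub>UP R\<^esub>i\<in>?D. y \<otimes>\<^bsub>UP R\<^esub> up_ring.monom (UP R) (?z i) i)"
      by (subst zrep, subst U.finsum_rdistr) (use y in auto)
    also have "\<dots> = (\<Oplus>\<^bsub>UP R\<^esub>i\<in>?D. up_ring.monom (UP R) (s (?z i)) i \<otimes>\<^bsub>UP R\<^esub> y)"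
    proof (rule U.finsum_cong')
      fix i
      show "y \<otimes>\<^bsub>UP R\<^esub> up_ring.monom (UP R) (?z i) i = up_ring.monom (UP R) (s (?z i)) i \<otimes>\<^bsub>UP R\<^esub> y"
      proof (rule U.up_eqI)
        fix N
        show "up_ring.coeff (UP R) (y \<otimes>\<^bsub>UP R\<^esub> up_ring.monom (UP R) (?z i) i) N =
          up_ring.coeff (UP R) (up_ring.monom (UP R) (s (?z i)) i \<otimes>\<^bsub>UP R\<^esub> y) N"
          using y s[OF zR] U.coeff_mult_monom_left[of y "s (?z i)" i N] U.coeff_mult_monom_right[of y "?z i" i N]
          by (simp del: U.coeff_mult)
      qed (use y s in auto)
    qed (use y s in auto)
    also have "\<dots> = r \<otimes>\<^bsub>UP R\<^esub> y"
      unfolding r_def by (subst U.finsum_ldistr) (use y s in auto)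
    finally have ry: "(r \<ominus>\<^bsub>UP R\<^esub> UK.smul q z) \<otimes>\<^bsub>UP R\<^esub> y = \<zero>\<^bsub>UP R\<^esub>"
      using y z rR yz by (simp add: U.minus_eq U.l_distr U.l_minus U.r_neg)
    have "r \<ominus>\<^bsub>UP R\<^esub> UK.smul q z = \<zero>\<^bsub>UP R\<^esub>"
      using nc_domain_mult_iff[OF U.nc_domain_UP[OF nc_domain] U.UP_ring] ry y z rR by simp
    then have "r = UK.smul q z" using rR z by simp
    then have "up_ring.coeff (UP R) r m = q \<star> ?z m" using z by (simp add: coeff_smul)
    moreover have "up_ring.coeff (UP R) r m = s (?z m)"
    proof -
      have "up_ring.coeff (UP R) r m = (\<Oplus>i\<in>?D. up_ring.coeff (UP R) (up_ring.monom (UP R) (s (?z i)) i) m)"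
        unfolding r_def by (rule U.coeff_finsum) (use s in auto)
      also have "\<dots> = (\<Oplus>i\<in>?D. if m = i then s (?z i) else \<zero>)"
        by (rule finsum_cong') (use s in auto)
      also have "\<dots> = s (?z m)" by (rule finsum_singleton) (use s in auto)
      finally show ?thesis .
    qed
    ultimately show ?thesis by simp
  qed
  \<comment> \<open>As \<open>s\<close> was chosen pointwise, its additivity on the components of
    \<open>?z m\<close> has to be derived: multiply by the nonzero \<open>?y n0\<close> and cancel.
    Since \<open>s\<close> preserves degrees, the relation for \<open>?z m\<close> then splits into
    its components.\<close>
  let ?c = "hcomp (?z m)"
  let ?V = "{v. ?c v \<noteq> \<zero>}"
  have fV: "finite ?V" by (rule hcomp_spec(2)) simp
  have c: "finsum R ?c ?V = ?z m" by (rule hcomp_spec(3)) simp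
  have scR: "s (?c v) \<in> carrier R" for v using s(1) by simp
  have "(\<Oplus>v\<in>?V. s (?c v)) \<otimes> ?y n0 = (\<Oplus>v\<in>?V. s (?c v) \<otimes> ?y n0)"
    by (rule finsum_ldistr) (use fV scR in auto)
  also have "\<dots> = (\<Oplus>v\<in>?V. ?y n0 \<otimes> ?c v)"
    by (rule finsum_cong') (use s in auto)
  also have "\<dots> = ?y n0 \<otimes> (\<Oplus>v\<in>?V. ?c v)"
    by (rule finsum_rdistr[symmetric]) (use fV in auto)
  also have "\<dots> = s (?z m) \<otimes> ?y n0" unfolding c using s by simp
  finally have e: "(\<Oplus>v\<in>?V. s (?c v)) \<otimes> ?y n0 = s (?z m) \<otimes> ?y n0" .
  have "(\<Oplus>v\<in>?V. s (?c v)) = s (?z m)"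
  proof (rule cancel_right[OF e])
    show "(\<Oplus>v\<in>?V. s (?c v)) \<in> carrier R" using scR by (intro finsum_closed) simp
    show "s (?z m) \<in> carrier R" using s(1) by simp
  qed (use n0 in auto)
  then have sum_s: "(\<Oplus>v\<in>?V. s (?c v)) = q \<star> ?z m" using sz by simp
  have s0: "s \<zero> = \<zero>" using s(2)[of \<zero> n0] s(1)[of \<zero>] n0 integral[of "s \<zero>" "?y n0"] by simp
  have "hcomp (q \<star> ?z m) = (\<lambda>v. s (?c v))"
    by (rule hcomp_unique[OF _ fV]) (auto simp: sum_s s0 intro!: sG hcomp_spec(1))
  then have "s (?c v) = q \<star> ?c v" using hcomp_smul[of "?z m" q v] by simp
  then show ?thesis using hcomp_s[OF hcomp_spec(1)[OF zR], of n w m v] by simp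
qed

end

section \<open>Exchanging generators for homogeneous components\<close>

context kalg
begin

lemma smul_cancel:
  assumes "c \<star> x = d \<star> x" "x \<in> carrier R" "x \<noteq> \<zero>"
  shows "c = d"
proof -
  have "(- d) \<star> x = \<ominus> (d \<star> x)" using smul_minus1[of "d \<star> x"] assms(2) by simp
  then have "(c - d) \<star> x = \<zero>"
    using add_smul[of x c "-d"] assms(1,2) by (simp add: r_neg)
  then show ?thesis using smul_eq_zero[of x "c - d"] assms by auto
qed

lemma eta_uminus: "eta (- c) = \<ominus> eta c"
  using smul_minus1[of "eta c"] by (simp add: smul_def flip: eta_mult)

text \<open>For constant 1 scalars can be subtracted freely; for any other constant nothing may be
  subtracted. \<open>aug_eq_0\<close> supplies this dichotomy.\<close>

lemma shift_comm:
  assumes [simp]: "u \<in> carrier R" "v \<in> carrier R" and vu: "v \<otimes> u = c \<star> (u \<otimes> v)"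
    and c: "c = 1 \<or> a = 0 \<and> b = 0"
  shows "(v \<ominus> eta b) \<otimes> (u \<ominus> eta a) = c \<star> ((u \<ominus> eta a) \<otimes> (v \<ominus> eta b))"
  using c
proof
  assume [simp]: "c = 1"
  have "(v \<ominus> eta b) \<otimes> (u \<ominus> eta a) = (v \<otimes> u \<oplus> v \<otimes> eta (- a)) \<oplus> (eta (- b) \<otimes> u \<oplus> eta (- b) \<otimes> eta (- a))"
    by (simp add: a_minus_def eta_uminus[symmetric] l_distr r_distr a_ac)
  also have "\<dots> = (u \<otimes> v \<oplus> u \<otimes> eta (- b)) \<oplus> (eta (- a) \<otimes> v \<oplus> eta (- a) \<otimes> eta (- b))"
    unfolding eta_central[of u "- b", simplified] eta_central[of v "- a", simplified] eta_mult[symmetric]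
    using vu by (simp add: a_assoc a_lcomm mult.commute)
  also have "\<dots> = (u \<ominus> eta a) \<otimes> (v \<ominus> eta b)"
    by (simp add: a_minus_def eta_uminus[symmetric] l_distr r_distr a_ac)
  finally show ?thesis by simp
qed (use vu in \<open>simp add: a_minus_def\<close>)

end

section \<open>The augmentation ideal of the polynomial extension and its square\<close>

context graded_kalg
begin

interpretation UK: kalg "UP R" "poly_unit R eta"
  by (rule kalg_UP)

abbreviation "cf_UP \<equiv> up_ring.coeff (UP R)"
abbreviation "mono_UP \<equiv> up_ring.monom (UP R)"

text \<open>The span of this set is \<open>k + m^2\<close> for the augmentation ideal
  \<open>m\<close> of \<open>R\<close>; including \<open>\<one>\<close> lets scalars be ignored
  together with products.\<close>

definition decomposable :: "'a set"
  where "decomposable = insert \<one> {g \<otimes> h | g h. \<exists>a b. a \<ge> 1 \<and> b \<ge> 1 \<and> g \<in> G a \<and> h \<in> G b}"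

lemma eps_zero_lspan:
  assumes x: "x \<in> carrier R" and e: "eps x = 0"
  shows "x \<in> lspan (\<Union>a\<in>{1..}. G a)"
proof -
  have "hcomp x n \<in> lspan (\<Union>a\<in>{1..}. G a)" for n
  proof (cases "n = 0")
    case True
    then show ?thesis using x e by (simp add: eps_eq_0_iff)
  next
    case False
    then show ?thesis by (intro lspan_base) (use x hcomp_spec(1)[OF x, of n] in auto)
  qed
  then have "finsum R (hcomp x) {n. hcomp x n \<noteq> \<zero>} \<in> lspan (\<Union>a\<in>{1..}. G a)"
    by (intro lspan_finsum hcomp_spec(2)[OF x])
  then show ?thesis using hcomp_spec(3)[OF x] by simp
qed

lemma mult_decomposable:
  assumes "x \<in> carrier R" "eps x = 0" "y \<in> carrier R" "eps y = 0"
  shows "x \<otimes> y \<in> lspan decomposable"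
proof (rule lspan_mult[OF eps_zero_lspan eps_zero_lspan])
  fix s t assume "s \<in> (\<Union>a\<in>{1..}. G a)" "t \<in> (\<Union>a\<in>{1..}. G a)" "s \<in> carrier R" "t \<in> carrier R"
  then show "s \<otimes> t \<in> lspan decomposable"
    by (intro lspan_base) (auto simp: decomposable_def)
qed (use assms in auto)

text \<open>The augmentation of \<open>UP R\<close>: it kills the variable and all elements of
  positive degree, and it is the identity on scalars.\<close>

definition aug :: "(nat \<Rightarrow> 'a) \<Rightarrow> 'k"
  where "aug r = eps (cf_UP r 0)"

lemma aug_add: "\<lbrakk>r \<in> carrier (UP R); s \<in> carrier (UP R)\<rbrakk> \<Longrightarrow> aug (r \<oplus>\<^bsub>UP R\<^esub> s) = aug r + aug s"
  by (simp add: aug_def eps_add)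

lemma aug_smul: "r \<in> carrier (UP R) \<Longrightarrow> aug (UK.smul c r) = c * aug r"
  by (simp add: aug_def coeff_smul eps_smul)

lemma aug_mult: "\<lbrakk>r \<in> carrier (UP R); s \<in> carrier (UP R)\<rbrakk> \<Longrightarrow> aug (r \<otimes>\<^bsub>UP R\<^esub> s) = aug r * aug s"
  using U.coeff_mult_one_term[of r s 0 0] by (simp add: aug_def eps_mult del: U.coeff_mult)

lemma aug_one [simp]: "aug \<one>\<^bsub>UP R\<^esub> = 1"
  by (simp add: aug_def)

lemma aug_zero [simp]: "aug \<zero>\<^bsub>UP R\<^esub> = 0"
  by (simp add: aug_def)

lemma aug_unit: "aug (poly_unit R eta c) = c"
  using aug_smul[of "\<one>\<^bsub>UP R\<^esub>" c] by (simp add: UK.smul_one)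

lemma aug_shift: "r \<in> carrier (UP R) \<Longrightarrow> aug (r \<ominus>\<^bsub>UP R\<^esub> poly_unit R eta (aug r)) = 0"
  by (simp add: U.minus_eq aug_add aug_unit flip: UK.eta_uminus)

text \<open>This is \<open>k + M\<^sup>2\<close>, where \<open>M\<close> is the kernel of \<open>aug\<close>.\<close>

definition base_and_square :: "(nat \<Rightarrow> 'a) set"
  where "base_and_square = {r \<in> carrier (UP R). cf_UP r 0 \<in> lspan decomposable \<and> eps (cf_UP r 1) = 0}"

text \<open>In the coefficient of degree 1 each summand contains the constant coefficient of
  \<open>r\<close> or of \<open>s\<close>, so \<open>eps\<close> kills it. The higher coefficients
  are unconstrained because the square of the variable already lies in \<open>M^2\<close>.\<close>

lemma mult_base_and_square:
  assumes r: "r \<in> carrier (UP R)" "aug r = 0" and s: "s \<in> carrier (UP R)" "aug s = 0"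
  shows "r \<otimes>\<^bsub>UP R\<^esub> s \<in> base_and_square"
proof -
  have "cf_UP (r \<otimes>\<^bsub>UP R\<^esub> s) 0 = cf_UP r 0 \<otimes> cf_UP s 0"
    using U.coeff_mult_one_term[of r s 0 0] r s by (simp del: U.coeff_mult)
  moreover have "cf_UP (r \<otimes>\<^bsub>UP R\<^esub> s) 1 = cf_UP r 1 \<otimes> cf_UP s 0 \<oplus> cf_UP r 0 \<otimes> cf_UP s 1"
    using r s by simp
  ultimately show ?thesis
    using r s by (simp add: base_and_square_def mult_decomposable aug_def eps_add eps_mult)
qed

lemma one_base_and_square: "\<one>\<^bsub>UP R\<^esub> \<in> base_and_square"
  by (simp add: base_and_square_def lspan_base decomposable_def)

text \<open>A subspace that contains \<open>k + M^2\<close> is closed under products: after the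
  scalars \<open>aug r\<close> and \<open>aug s\<close> are split off, the remaining product lies in
  \<open>M^2\<close>.\<close>

lemma lspan_base_and_square_mult:
  assumes Q: "base_and_square \<subseteq> T" and r: "r \<in> UK.lspan T" and s: "s \<in> UK.lspan T"
  shows "r \<otimes>\<^bsub>UP R\<^esub> s \<in> UK.lspan T"
proof -
  have rs [simp]: "r \<in> carrier (UP R)" "s \<in> carrier (UP R)" using r s UK.lspan_carrier by auto
  have Q': "x \<in> UK.lspan T" if "x \<in> base_and_square" for x
    using that Q by (intro UK.lspan_base) (auto simp: base_and_square_def)
  let ?a = "poly_unit R eta (aug r)" and ?b = "poly_unit R eta (aug s)"
  define r0 where "r0 = r \<ominus>\<^bsub>UP R\<^esub> ?a"
  define s0 where "s0 = s \<ominus>\<^bsub>UP R\<^esub> ?b"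
  have ab: "poly_unit R eta c \<in> UK.lspan T" for c
    using UK.lspan_smul[OF Q'[OF one_base_and_square], of c] by (simp add: UK.smul_one)
  have r0: "r0 \<in> UK.lspan T" "aug r0 = 0" and s0: "s0 \<in> UK.lspan T" "aug s0 = 0"
    unfolding r0_def s0_def using UK.lspan_minus r s ab aug_shift by auto
  have [simp]: "r0 \<in> carrier (UP R)" "s0 \<in> carrier (UP R)" using r0 s0 UK.lspan_carrier by auto
  have req: "r = r0 \<oplus>\<^bsub>UP R\<^esub> ?a" unfolding r0_def 
    by (simp add: U.minus_eq U.a_assoc U.l_neg)
  have seq: "s = s0 \<oplus>\<^bsub>UP R\<^esub> ?b" unfolding s0_def 
    by (simp add: U.minus_eq U.a_assoc U.l_neg)
  have "r \<otimes>\<^bsub>UP R\<^esub> s = (r0 \<otimes>\<^bsub>UP R\<^esub> s0 \<oplus>\<^bsub>UP R\<^esub> UK.smul (aug s) r0) \<oplus>\<^bsub>UP R\<^esub> UK.smul (aug r) s"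
  proof -
    have "r \<otimes>\<^bsub>UP R\<^esub> s = r0 \<otimes>\<^bsub>UP R\<^esub> s \<oplus>\<^bsub>UP R\<^esub> ?a \<otimes>\<^bsub>UP R\<^esub> s"
      by (subst req) (simp add: U.l_distr)
    also have "r0 \<otimes>\<^bsub>UP R\<^esub> s = r0 \<otimes>\<^bsub>UP R\<^esub> s0 \<oplus>\<^bsub>UP R\<^esub> r0 \<otimes>\<^bsub>UP R\<^esub> ?b"
      by (subst seq) (simp add: U.r_distr)
    finally show ?thesis by (simp add: UK.smul_def UK.eta_central)
  qed
  moreover have "r0 \<otimes>\<^bsub>UP R\<^esub> s0 \<in> UK.lspan T"
    by (intro Q' mult_base_and_square) (simp_all add: r0 s0)
  ultimately show ?thesis using r0 s UK.lspan_add UK.lspan_smul by metis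
qed

text \<open>The bihomogeneous components of \<open>y\<close> span \<open>y\<close>, so they are
  admissible candidates in \<open>lspan_exchange\<close>.\<close>

lemma exchange_component:
  assumes full: "carrier (UP R) = UK.lspan (insert y T)" and y: "y \<in> carrier (UP R)"
  shows "\<exists>n w. carrier (UP R) = UK.lspan (insert (mono_UP (hcomp (cf_UP y n) w) n) T)"
proof -
  let ?C = "{mono_UP (hcomp (cf_UP y n) w) n | n w. True}"
  have "mono_UP (cf_UP y n) n \<in> UK.lspan ?C" for n
  proof (rule monom_lspan)
    have "finsum R (hcomp (cf_UP y n)) {w. hcomp (cf_UP y n) w \<noteq> \<zero>} \<in> lspan (range (hcomp (cf_UP y n)))"
      by (rule lspan_finsum) (use y hcomp_spec(2) in \<open>auto intro: lspan_base\<close>)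
    then show "cf_UP y n \<in> lspan (range (hcomp (cf_UP y n)))" using hcomp_spec(3) y by simp
    show "mono_UP s n \<in> UK.lspan ?C" if "s \<in> range (hcomp (cf_UP y n))" for s
      by (rule UK.lspan_base) (use that y in auto)
  qed
  then have "y \<in> UK.lspan ?C"
    by (subst U.up_repr[OF y, symmetric]) (rule UK.lspan_finsum; simp)
  then have "\<exists>c\<in>?C. carrier (UP R) = UK.lspan (insert c T)"
    by (rule UK.lspan_exchange[OF full]) (use y in auto)
  then show ?thesis by blast
qed

section \<open>Commutation between bihomogeneous components\<close>

definition comps_commute :: "'k \<Rightarrow> (nat \<Rightarrow> 'a) \<Rightarrow> (nat \<Rightarrow> 'a) \<Rightarrow> bool"
  where "comps_commute q y z \<longleftrightarrow> (\<forall>n w m v. hcomp (cf_UP y n) w \<otimes> hcomp (cf_UP z m) v = 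
     q \<star> (hcomp (cf_UP z m) v \<otimes> hcomp (cf_UP y n) w))"

lemma comps_commute_sym: "comps_commute 1 y z \<Longrightarrow> y \<in> carrier (UP R) \<Longrightarrow> z \<in> carrier (UP R) \<Longrightarrow> comps_commute 1 z y"
  by (simp add: comps_commute_def)

lemma nonzero_component:
  assumes "y \<in> carrier (UP R)" "y \<noteq> \<zero>\<^bsub>UP R\<^esub>"
  obtains n w where "hcomp (cf_UP y n) w \<noteq> \<zero>"
  using U.lcoeff_nonzero[OF assms(2,1)] homog_hcomp[of "cf_UP y (deg R y)" 0] assms(1) U.coeff_closed by metis

text \<open>A nonzero scalar commutes with everything, so its relation with a nonzero component of
  the other element forces the constant to be 1.\<close>

lemma comps_commute_const:
  assumes q: "comps_commute q y z" and y: "y \<in> carrier (UP R)" "y \<noteq> \<zero>\<^bsub>UP R\<^esub>"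
    and z: "z \<in> carrier (UP R)" "z \<noteq> \<zero>\<^bsub>UP R\<^esub>" and c: "c \<noteq> 0"
    and yz: "hcomp (cf_UP y n) w = eta c \<or> hcomp (cf_UP z n) w = eta c"
  shows "q = 1"
proof -
  have *: "q = 1" if "(q * c) \<star> x = c \<star> x" "x \<in> carrier R" "x \<noteq> \<zero>" for x
    using smul_cancel[OF that] c by simp
  show ?thesis
    using yz
  proof
    assume 1: "hcomp (cf_UP y n) w = eta c"
    obtain m v where x: "hcomp (cf_UP z m) v \<noteq> \<zero>" using nonzero_component[OF z] .
    have "eta c \<otimes> hcomp (cf_UP z m) v = q \<star> (eta c \<otimes> hcomp (cf_UP z m) v)"
      using q z unfolding comps_commute_def by (metis 1 eta_central hcomp_closed U.coeff_closed)
    then show ?thesis using z by (intro *[OF _ _ x]) (simp_all flip: smul_def)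
  next
    assume 1: "hcomp (cf_UP z n) w = eta c"
    obtain m v where x: "hcomp (cf_UP y m) v \<noteq> \<zero>" using nonzero_component[OF y] .
    have "eta c \<otimes> hcomp (cf_UP y m) v = q \<star> (eta c \<otimes> hcomp (cf_UP y m) v)"
      using q y unfolding comps_commute_def by (metis 1 eta_central hcomp_closed U.coeff_closed)
    then show ?thesis using y by (intro *[OF _ _ x]) (simp_all flip: smul_def)
  qed
qed

definition component :: "(nat \<Rightarrow> 'a) \<Rightarrow> 'a \<Rightarrow> nat \<Rightarrow> bool"
  where "component y v w \<longleftrightarrow> v \<in> G w \<and> (v = \<zero> \<or> (\<exists>n w'. v = hcomp (cf_UP y n) w'))"

lemma component_commute: "\<lbrakk>comps_commute q y z; component y v w; component z v' w'\<rbrakk> \<Longrightarrow> v \<otimes> v' = q \<star> (v' \<otimes> v)"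
  unfolding comps_commute_def component_def by (elim conjE disjE) (auto simp: G_carrier)

text \<open>A component of degree 0 is a scalar, hence already in the span of
  \<open>decomposable\<close>, and zero can stand in for it. The degree 1 given to zero is
  arbitrary.\<close>

lemma component_positive: "component y v w \<Longrightarrow> \<exists>v' w'. component y v' w' \<and> w' \<ge> 1 \<and> v \<in> lspan (insert v' decomposable)"
proof (cases "w = 0")
  case True
  assume "component y v w"
  then obtain c where "v = c \<star> \<one>" using True by (auto simp: component_def G_0 smul_one)
  moreover have "c \<star> \<one> \<in> lspan (insert \<zero> decomposable)"
    by (intro lspan_smul lspan_base) (auto simp: decomposable_def)
  ultimately show ?thesis by (intro exI[of _ \<zero>] exI[of _ 1]) (auto simp: component_def)
next
  case False
  assume "component y v w"
  then show ?thesis using False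
    by (intro exI[of _ v] exI[of _ w]) (auto simp: component_def G_carrier intro!: lspan_base)
qed

text \<open>Generation is expressed modulo decomposables, the form that linear exchange produces;
  \<open>homogeneous_gens_full\<close> turns it into generation of the algebra.\<close>

definition homogeneous_gens :: "(nat \<Rightarrow> nat \<Rightarrow> 'k) \<Rightarrow> bool"
  where "homogeneous_gens p \<longleftrightarrow> (\<exists>z1 z2 z3 w1 w2 w3. z1 \<in> G w1 \<and> z2 \<in> G w2 \<and> z3 \<in> G w3 \<and> 
    w1 \<ge> 1 \<and> w2 \<ge> 1 \<and> w3 \<ge> 1 \<and> qtriple R eta p z1 z2 z3 \<and>
    carrier R = lspan (insert z1 (insert z2 (insert z3 decomposable))))"

lemma homogeneous_gensI:
  assumes component: "component y1 v1 w1" "component y2 v2 w2" "component y3 v3 w3"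
    and comps_commute: "comps_commute (p 1 2) y2 y1" "comps_commute (p 1 3) y3 y1" "comps_commute (p 2 3) y3 y2"
    and full: "carrier R = lspan (insert v1 (insert v2 (insert v3 decomposable)))"
  shows "homogeneous_gens p"
proof -
  obtain z1 d1 where z1: "component y1 z1 d1" "d1 \<ge> 1" "v1 \<in> lspan (insert z1 decomposable)"
    using component_positive[OF component(1)] by blast
  obtain z2 d2 where z2: "component y2 z2 d2" "d2 \<ge> 1" "v2 \<in> lspan (insert z2 decomposable)"
    using component_positive[OF component(2)] by blast
  obtain z3 d3 where z3: "component y3 z3 d3" "d3 \<ge> 1" "v3 \<in> lspan (insert z3 decomposable)"
    using component_positive[OF component(3)] by blast
  let ?T = "insert z1 (insert z2 (insert z3 decomposable))"
  have zR: "z1 \<in> carrier R" "z2 \<in> carrier R" "z3 \<in> carrier R"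
    using z1 z2 z3 G_carrier by (auto simp: component_def)
  have "qtriple R eta p z1 z2 z3"
    using zR component_commute[OF comps_commute(1) z2(1) z1(1)] component_commute[OF comps_commute(2) z3(1) z1(1)] component_commute[OF comps_commute(3) z3(1) z2(1)]
    by unfold_locales simp_all
  moreover have "carrier R = lspan ?T"
  proof
    have sub: "lspan (insert z1 decomposable) \<subseteq> lspan ?T" "lspan (insert z2 decomposable) \<subseteq> lspan ?T"
      "lspan (insert z3 decomposable) \<subseteq> lspan ?T" by (intro lspan_mono; blast)+
    show "carrier R \<subseteq> lspan ?T"
    proof
      fix x assume "x \<in> carrier R"
      then have "x \<in> lspan (insert v1 (insert v2 (insert v3 decomposable)))" using full by simp
      then show "x \<in> lspan ?T"
      proof (rule lspan_sub)
        fix s assume "s \<in> insert v1 (insert v2 (insert v3 decomposable))" "s \<in> carrier R"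
        then show "s \<in> lspan ?T" using z1(3) z2(3) z3(3) sub by (auto intro: lspan_base)
      qed
    qed
  qed (use lspan_carrier in blast)
  ultimately show ?thesis
    unfolding homogeneous_gens_def using z1 z2 z3 unfolding component_def by blast
qed

end

section \<open>Generation by homogeneous elements\<close>

context graded_kalg
begin

interpretation UK: kalg "UP R" "poly_unit R eta"
  by (rule kalg_UP)

lemma hcomp_lspan:
  assumes "x \<in> lspan S" "\<And>s. \<lbrakk>s \<in> S; s \<in> carrier R\<rbrakk> \<Longrightarrow> hcomp s n \<in> lspan T"
  shows "hcomp x n \<in> lspan T"
  using assms
  by (induction rule: lspan.induct)
    (auto simp: hcomp_zero hcomp_add hcomp_smul lspan_carrier lspan_add lspan_smul)

lemma lspan_insert_zero: "lspan (insert \<zero> T) = lspan T"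
proof
  show "lspan (insert \<zero> T) \<subseteq> lspan T" using lspan_sub[of _ "insert \<zero> T" T] lspan_base by blast
qed (rule lspan_mono, blast)

text \<open>A graded Nakayama argument by strong induction on the degree: a decomposable element of
  degree \<open>n\<close> has two factors of positive degree, hence of degree below
  \<open>n\<close>. In degree 0 there are only scalars.\<close>

lemma homogeneous_gens_full:
  assumes z: "qtriple R eta p z1 z2 z3"
    and w: "z1 \<in> G w1" "z2 \<in> G w2" "z3 \<in> G w3"
    and full: "carrier R = lspan (insert z1 (insert z2 (insert z3 decomposable)))"
  shows "lspan (range (qtriple.tmon R z1 z2 z3)) = carrier R"
proof -
  interpret Z: qtriple R eta p z1 z2 z3 by (rule z)
  let ?H = "lspan (range Z.tmon)"
  have tm: "Z.tmon m \<in> ?H" for m by (rule lspan_base) auto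
  have Hmult: "x \<otimes> y \<in> ?H" if "x \<in> ?H" "y \<in> ?H" for x y
    using that
  proof (rule lspan_mult)
    fix s t assume "s \<in> range Z.tmon" "t \<in> range Z.tmon"
    then obtain m n where "s = Z.tmon m" "t = Z.tmon n" by blast
    then show "s \<otimes> t \<in> ?H" using Z.tmon_mult lspan_smul[OF tm] by metis
  qed
  have zH: "z1 \<in> ?H" "z2 \<in> ?H" "z3 \<in> ?H"
    using tm[of "(1, 0, 0)"] tm[of "(0, 1, 0)"] tm[of "(0, 0, 1)"] by simp_all
  have G: "b \<in> ?H" if "b \<in> G n" for b n
    using that
  proof (induction n arbitrary: b rule: less_induct)
    case (less n)
    show ?case
    proof (cases "n = 0")
      case True
      then obtain c where "b = c \<star> Z.tmon (0, 0, 0)"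
        using less(2) by (auto simp: G_0 smul_one)
      then show ?thesis using lspan_smul[OF tm] by metis
    next
      case False
      have b: "b \<in> lspan (insert z1 (insert z2 (insert z3 decomposable)))"
        using G_carrier[OF less(2)] full by simp
      have "hcomp b n \<in> ?H"
      proof (rule hcomp_lspan[OF b])
        fix s assume s: "s \<in> insert z1 (insert z2 (insert z3 decomposable))" "s \<in> carrier R"
        have gh: "hcomp (g \<otimes> h) n \<in> ?H" if "g \<in> G a" "h \<in> G b" "a \<ge> 1" "b \<ge> 1" for g h a b
        proof (cases "n = a + b")
          case True
          then show ?thesis
            using hcomp_homog[OF G_mult[OF that(1,2)]] Hmult[OF less(1)[OF _ that(1)] less(1)[OF _ that(2)]] that(3,4)
            by simp
        next
          case False
          then show ?thesis using hcomp_homog[OF G_mult[OF that(1,2)]] by simp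
        qed
        consider "s = \<one>" | "s = z1" | "s = z2" | "s = z3" | g h a b where "s = g \<otimes> h" "a \<ge> 1" "b \<ge> 1" "g \<in> G a" "h \<in> G b"
          using s(1) unfolding decomposable_def by blast
        then show "hcomp s n \<in> ?H"
        proof cases
          case 1
          then show ?thesis using \<open>n \<noteq> 0\<close> by (simp add: hcomp_one)
        qed (use zH gh hcomp_homog[OF w(1)] hcomp_homog[OF w(2)] hcomp_homog[OF w(3)] in auto)
      qed
      then show ?thesis using hcomp_homog[OF less(2)] by simp
    qed
  qed
  have "b \<in> ?H" if "b \<in> carrier R" for b
    using that by (induction rule: graded_induct) (auto intro: G lspan_add)
  then show ?thesis using lspan_carrier by blast
qed

section \<open>Generators of the polynomial extension with prescribed relations\<close>

context
  fixes p :: "nat \<Rightarrow> nat \<Rightarrow> 'k" and y1 y2 y3 t :: "nat \<Rightarrow> 'a"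
  assumes Y: "qquad (UP R) (poly_unit R eta) p y1 y2 y3 t"
    and Yfull: "UK.lspan (range (qquad.qmon (UP R) y1 y2 y3 t)) = carrier (UP R)"
    and nz: "y1 \<noteq> \<zero>\<^bsub>UP R\<^esub>" "y2 \<noteq> \<zero>\<^bsub>UP R\<^esub>" "y3 \<noteq> \<zero>\<^bsub>UP R\<^esub>" "t \<noteq> \<zero>\<^bsub>UP R\<^esub>"
    and normal: "\<And>y r. \<lbrakk>y \<in> {y2, y3}; r \<in> carrier (UP R)\<rbrakk> 
      \<Longrightarrow> \<exists>r'\<in>carrier (UP R). y \<otimes>\<^bsub>UP R\<^esub> r = r' \<otimes>\<^bsub>UP R\<^esub> y"
begin

interpretation Y: qquad "UP R" "poly_unit R eta" p y1 y2 y3 t by (rule Y)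

text \<open>\<open>normal_components\<close> takes the normal element as left factor; in these
  relations it is \<open>y2\<close>, \<open>y3\<close> or the central \<open>t\<close>.\<close>

lemma comps_commute_gens: "comps_commute (p 1 2) y2 y1" "comps_commute (p 1 3) y3 y1" "comps_commute (p 2 3) y3 y2"
  "y \<in> carrier (UP R) \<Longrightarrow> comps_commute 1 t y"
proof -
  show "comps_commute (p 1 2) y2 y1" unfolding comps_commute_def
    by (intro allI normal_components normal) (use nz Y.u21 in auto)
  show "comps_commute (p 1 3) y3 y1" unfolding comps_commute_def
    by (intro allI normal_components normal) (use nz Y.u31 in auto)
  show "comps_commute (p 2 3) y3 y2" unfolding comps_commute_def
    by (intro allI normal_components normal) (use nz Y.u32 in auto)
  show "comps_commute 1 t y" if "y \<in> carrier (UP R)" unfolding comps_commute_def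
  proof (intro allI normal_components)
    show "\<exists>r'\<in>carrier (UP R). t \<otimes>\<^bsub>UP R\<^esub> r = r' \<otimes>\<^bsub>UP R\<^esub> t" if "r \<in> carrier (UP R)" for r
      using Y.t_central that by blast
    show "t \<otimes>\<^bsub>UP R\<^esub> y = UK.smul 1 (y \<otimes>\<^bsub>UP R\<^esub> t)" using Y.t_central that by simp
  qed (use that nz in auto)
qed

text \<open>By \<open>lspan_base_and_square_mult\<close> the span on the right is a subalgebra, and
  it contains the four generators.\<close>

lemma UP_gens: "carrier (UP R) = UK.lspan (insert y1 (insert y2 (insert y3 (insert t base_and_square))))"
proof -
  let ?T = "insert y1 (insert y2 (insert y3 (insert t base_and_square)))"
  have "Y.qmon x \<in> UK.lspan ?T" for x
  proof (rule Y.qmon_mem_sub)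
    show "\<one>\<^bsub>UP R\<^esub> \<in> UK.lspan ?T" by (rule UK.lspan_base) (auto simp: one_base_and_square)
    show "x \<otimes>\<^bsub>UP R\<^esub> y \<in> UK.lspan ?T" if "x \<in> UK.lspan ?T" "y \<in> UK.lspan ?T" for x y
      by (rule lspan_base_and_square_mult[OF _ that]) auto
    show "{y1, y2, y3, t} \<subseteq> UK.lspan ?T" by (auto intro!: UK.lspan_base)
  qed
  then have "UK.lspan (range Y.qmon) \<subseteq> UK.lspan ?T"
    using UK.lspan_sub[of _ "range Y.qmon"] by blast
  then show ?thesis using Yfull UK.lspan_carrier by blast
qed

lemma homogeneous_gens: "homogeneous_gens p"
proof -
  define u where "u y n w = mono_UP (hcomp (cf_UP y n) w) n" for y n w
  note ex = exchange_component[folded u_def]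
  have f0: "carrier (UP R) = UK.lspan (insert y1 (insert y2 (insert y3 (insert t base_and_square))))"
    by (rule UP_gens)
  \<comment> \<open>One exchange for each generator. The term \<open>u y n w\<close> keeps the name
    of its generator \<open>y\<close>, which determines its commutation relations;
    \<open>insert_commute\<close> merely brings the next generator to the front.\<close>
  obtain n1 w1 where "carrier (UP R) = UK.lspan (insert (u y1 n1 w1) (insert y2 (insert y3 (insert t base_and_square))))"
    using ex[OF f0 Y.u_closed(1)] by blast
  then have f1: "carrier (UP R) = UK.lspan (insert y2 (insert (u y1 n1 w1) (insert y3 (insert t base_and_square))))"
    by (simp only: insert_commute)
  obtain n2 w2 where "carrier (UP R) = UK.lspan (insert (u y2 n2 w2) (insert (u y1 n1 w1) (insert y3 (insert t base_and_square))))"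
    using ex[OF f1 Y.u_closed(2)] by blast
  then have f2: "carrier (UP R) = UK.lspan (insert y3 (insert (u y2 n2 w2) (insert (u y1 n1 w1) (insert t base_and_square))))"
    by (simp only: insert_commute)
  obtain n3 w3 where "carrier (UP R) = UK.lspan (insert (u y3 n3 w3) (insert (u y2 n2 w2) (insert (u y1 n1 w1) (insert t base_and_square))))"
    using ex[OF f2 Y.u_closed(3)] by blast
  then have f3: "carrier (UP R) = UK.lspan (insert t (insert (u y3 n3 w3) (insert (u y2 n2 w2) (insert (u y1 n1 w1) base_and_square))))"
    by (simp only: insert_commute)
  obtain n4 w4 where f4: "carrier (UP R) = UK.lspan (insert (u t n4 w4) (insert (u y3 n3 w3) (insert (u y2 n2 w2) (insert (u y1 n1 w1) base_and_square))))"
    using ex[OF f3 Y.t_closed] by blast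
  let ?U = "{u t n4 w4, u y3 n3 w3, u y2 n2 w2, u y1 n1 w1}"
  note yR [simp] = Y.u_closed Y.t_closed
  define v where "v y n w = (if n = 0 then hcomp (cf_UP y n) w else \<zero>)" for y n w
  have coeff_u: "cf_UP (u y n w) 0 = v y n w" if "y \<in> carrier (UP R)" for y n w
    using that by (simp add: u_def v_def)
  have component_v: "component y (v y n w) w" if "y \<in> carrier (UP R)" for y n w
    using that hcomp_spec(1) by (auto simp: component_def v_def)
  \<comment> \<open>Taking constant coefficients in \<open>f4\<close> maps \<open>UP R\<close> onto
    \<open>R\<close> and \<open>base_and_square\<close> into the span of
    \<open>decomposable\<close>.\<close>
  have full_v: "carrier R = lspan (insert (v t n4 w4) (insert (v y3 n3 w3) (insert (v y2 n2 w2) (insert (v y1 n1 w1) decomposable))))"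
    (is "_ = lspan ?V")
  proof
    show "carrier R \<subseteq> lspan ?V"
    proof
      fix b assume b: "b \<in> carrier R"
      have "mono_UP b 0 \<in> UK.lspan (insert (u t n4 w4) (insert (u y3 n3 w3) (insert (u y2 n2 w2) (insert (u y1 n1 w1) base_and_square))))"
        unfolding f4[symmetric] using b by simp
      then have "cf_UP (mono_UP b 0) 0 \<in> lspan ?V"
      proof (rule coeff_lspan)
        fix s assume s: "s \<in> insert (u t n4 w4) (insert (u y3 n3 w3) (insert (u y2 n2 w2) (insert (u y1 n1 w1) base_and_square)))"
          "s \<in> carrier (UP R)"
        have "lspan decomposable \<subseteq> lspan ?V" by (rule lspan_mono) auto
        then have Q: "cf_UP s 0 \<in> lspan ?V" if "s \<in> base_and_square"
          using that unfolding base_and_square_def by blast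
        have V: "v y n w \<in> lspan ?V" if "v y n w \<in> ?V" "y \<in> carrier (UP R)" for y n w
          using that by (intro lspan_base) (auto simp: v_def)
        show "cf_UP s 0 \<in> lspan ?V"
          using s(1) by (elim insertE) (simp_all only: coeff_u yR Q V insert_iff simp_thms)
      qed
      then show "b \<in> lspan ?V" using b by simp
    qed
  qed (use lspan_carrier in blast)
  \<comment> \<open>The linear map taking \<open>r\<close> to \<open>eps (cf_UP r 1)\<close>
    vanishes on \<open>base_and_square\<close> and is 1 on the variable, so it cannot vanish on all
    four chosen components.\<close>
  have "\<exists>x\<in>?U. eps (cf_UP x 1) \<noteq> 0"
  proof (rule ccontr)
    assume "\<not> ?thesis"
    then have z: "eps (cf_UP s 1) = 0" if "s \<in> ?U \<union> base_and_square" for s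
      using that by (auto simp: base_and_square_def)
    have "eps (cf_UP x 1) = 0" if "x \<in> UK.lspan (?U \<union> base_and_square)" for x
      using that
    proof (induction rule: UK.lspan.induct)
      case (lspan_step x s c)
      then show ?case using z[OF lspan_step(2)] 
        by (simp add: UK.lspan_carrier coeff_smul eps_add eps_smul)
    qed simp
    moreover have "mono_UP \<one> 1 \<in> UK.lspan (?U \<union> base_and_square)"
      unfolding insert_is_Un[of _ "{}", symmetric] Un_insert_left Un_empty_left f4[symmetric] by simp
    ultimately have "eps (cf_UP (mono_UP \<one> 1) 1) = 0" by blast
    then show False by simp
  qed
  \<comment> \<open>Such a component has degree 1 in the variable and degree 0 in the grading: it is
    a nonzero scalar multiple of the variable. Its constant coefficient is zero, which leaves three
    elements to generate \<open>R\<close>.\<close>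
  moreover have const: "v y n w = \<zero> \<and> (\<exists>c. c \<noteq> 0 \<and> hcomp (cf_UP y n) w = eta c)"
    if y: "y \<in> carrier (UP R)" and e: "eps (cf_UP (u y n w) 1) \<noteq> 0" for y n w
  proof -
    let ?b = "hcomp (cf_UP y n) w"
    have bG: "?b \<in> G w" and bR: "?b \<in> carrier R" using y hcomp_spec(1) by auto
    have n: "n = 1" using e bR by (cases "n = 1") (auto simp: u_def)
    then have eb: "eps ?b \<noteq> 0" using e bR by (simp add: u_def)
    then have "hcomp ?b 0 \<noteq> \<zero>" using bR eps_eq_0_iff by simp
    then have "w = 0" using hcomp_homog[OF bG] by (auto split: if_splits)
    then obtain c where c: "?b = eta c" using bG G_0 by auto
    moreover have "c \<noteq> 0" using c eb by auto
    ultimately show ?thesis using n by (auto simp: v_def)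
  qed
  ultimately consider "v t n4 w4 = \<zero>"
    | c where "v y3 n3 w3 = \<zero>" "c \<noteq> 0" "hcomp (cf_UP y3 n3) w3 = eta c"
    | c where "v y2 n2 w2 = \<zero>" "c \<noteq> 0" "hcomp (cf_UP y2 n2) w2 = eta c"
    | c where "v y1 n1 w1 = \<zero>" "c \<noteq> 0" "hcomp (cf_UP y1 n1) w1 = eta c"
    using yR by (elim bexE insertE) blast+
  then show ?thesis
  proof cases
    case 1
    then have "carrier R = lspan (insert (v y1 n1 w1) (insert (v y2 n2 w2) (insert (v y3 n3 w3) decomposable)))"
      using full_v lspan_insert_zero by (simp add: insert_commute)
    then show ?thesis by (rule homogeneous_gensI[of y1 _ w1 y2 _ w2 y3 _ w3, rotated 6]) (use component_v comps_commute_gens in auto)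
  next
    case 2
    then have f: "carrier R = lspan (insert (v y1 n1 w1) (insert (v y2 n2 w2) (insert (v t n4 w4) decomposable)))"
      using full_v lspan_insert_zero by (simp add: insert_commute)
    \<comment> \<open>The scalar found in \<open>y3\<close> makes both relations of the third index
      commutative, so a component of the central \<open>t\<close> can take the third place.\<close>
    have "p 1 3 = 1" "p 2 3 = 1"
      using comps_commute_const[OF comps_commute_gens(2) _ nz(3) _ nz(1), of c n3 w3] comps_commute_const[OF comps_commute_gens(3) _ nz(3) _ nz(2), of c n3 w3] 2 by auto
    then show ?thesis
      using f by (intro homogeneous_gensI[of y1 _ w1 y2 _ w2 t _ w4]) (use component_v comps_commute_gens in auto)
  next
    case 3
    then have f: "carrier R = lspan (insert (v y1 n1 w1) (insert (v t n4 w4) (insert (v y3 n3 w3) decomposable)))"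
      using full_v lspan_insert_zero by (simp add: insert_commute)
    \<comment> \<open>Here \<open>t\<close> also becomes the right factor of a relation; with
      constant 1 the relation is turned around by \<open>comps_commute_sym\<close>.\<close>
    have "p 1 2 = 1" "p 2 3 = 1"
      using comps_commute_const[OF comps_commute_gens(1) _ nz(2) _ nz(1), of c n2 w2] comps_commute_const[OF comps_commute_gens(3) _ nz(3) _ nz(2), of c n2 w2] 3 by auto
    then show ?thesis
      using f by (intro homogeneous_gensI[of y1 _ w1 t _ w4 y3 _ w3]) (use component_v comps_commute_gens comps_commute_sym in auto)
  next
    case 4
    then have f: "carrier R = lspan (insert (v t n4 w4) (insert (v y2 n2 w2) (insert (v y3 n3 w3) decomposable)))"
      using full_v lspan_insert_zero by (simp add: insert_commute)
    have "p 1 2 = 1" "p 1 3 = 1"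
      using comps_commute_const[OF comps_commute_gens(1) _ nz(2) _ nz(1), of c n1 w1] comps_commute_const[OF comps_commute_gens(2) _ nz(3) _ nz(1), of c n1 w1] 4 by auto
    then show ?thesis
      using f by (intro homogeneous_gensI[of t _ w4 y2 _ w2 y3 _ w3]) (use component_v comps_commute_gens comps_commute_sym in auto)
  qed
qed

section \<open>Translation into the augmentation ideal, and independence\<close>

definition shift :: "(nat \<Rightarrow> 'a) \<Rightarrow> nat \<Rightarrow> 'a"
  where "shift y = y \<ominus>\<^bsub>UP R\<^esub> poly_unit R eta (aug y)"

text \<open>The scalar \<open>aug y\<close> is itself a bihomogeneous component of \<open>y\<close>,
  so if it is nonzero \<open>comps_commute_const\<close> applies to it.\<close>

lemma aug_eq_0:
  assumes "comps_commute q y z" "y \<in> carrier (UP R)" "y \<noteq> \<zero>\<^bsub>UP R\<^esub>" "z \<in> carrier (UP R)" "z \<noteq> \<zero>\<^bsub>UP R\<^esub>" 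
  shows "q = 1 \<or> aug z = 0 \<and> aug y = 0"
  using comps_commute_const[OF assms, of "aug y" 0 0] comps_commute_const[OF assms, of "aug z" 0 0] assms(2,4)
  by (auto simp: aug_def eta_eps)

lemma shifted: "qquad (UP R) (poly_unit R eta) p (shift y1) (shift y2) (shift y3) (shift t)"
proof -
  have closed [simp]: "shift y \<in> carrier (UP R)" if "y \<in> carrier (UP R)" for y
    using that by (simp add: shift_def)
  show ?thesis
  proof unfold_locales
    show "shift y2 \<otimes>\<^bsub>UP R\<^esub> shift y1 = UK.smul (p 1 2) (shift y1 \<otimes>\<^bsub>UP R\<^esub> shift y2)"
      unfolding shift_def by (intro UK.shift_comm Y.u21 aug_eq_0 comps_commute_gens nz) auto
    show "shift y3 \<otimes>\<^bsub>UP R\<^esub> shift y1 = UK.smul (p 1 3) (shift y1 \<otimes>\<^bsub>UP R\<^esub> shift y3)"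
      unfolding shift_def by (intro UK.shift_comm Y.u31 aug_eq_0 comps_commute_gens nz) auto
    show "shift y3 \<otimes>\<^bsub>UP R\<^esub> shift y2 = UK.smul (p 2 3) (shift y2 \<otimes>\<^bsub>UP R\<^esub> shift y3)"
      unfolding shift_def by (intro UK.shift_comm Y.u32 aug_eq_0 comps_commute_gens nz) auto
    show "shift t \<otimes>\<^bsub>UP R\<^esub> x = x \<otimes>\<^bsub>UP R\<^esub> shift t" if "x \<in> carrier (UP R)" for x
      using UK.shift_comm[of x t 1 0 "aug t"] Y.t_central[OF that] that
      by (simp add: shift_def U.minus_eq)
  qed simp_all
qed

interpretation Z: qquad "UP R" "poly_unit R eta" p "shift y1" "shift y2" "shift y3" "shift t"
  by (rule shifted)

lemma shift_qspan: "{y1, y2, y3, t} \<subseteq> Z.qspan (\<lambda>n. n \<le> 1)"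
proof -
  have g: "{shift y1, shift y2, shift y3, shift t} \<subseteq> Z.qspan (\<lambda>n. n \<le> 1)"
    by (rule Z.gen_qspan) simp
  have "\<one>\<^bsub>UP R\<^esub> \<in> Z.qspan (\<lambda>n. n \<le> 1)" by (rule Z.one_qspan) simp
  then have u: "poly_unit R eta c \<in> Z.qspan (\<lambda>n. n \<le> 1)" for c
    using UK.lspan_smul[of "\<one>\<^bsub>UP R\<^esub>" _ c] by (simp only: UK.smul_one)
  have "y = shift y \<oplus>\<^bsub>UP R\<^esub> poly_unit R eta (aug y)" if "y \<in> carrier (UP R)" for y
    using that by (simp add: shift_def U.minus_eq U.a_assoc U.l_neg)
  then have "y \<in> Z.qspan (\<lambda>n. n \<le> 1)" if "y \<in> carrier (UP R)" "shift y \<in> Z.qspan (\<lambda>n. n \<le> 1)" for y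
    using that u UK.lspan_add by metis
  then show ?thesis using g by simp
qed

text \<open>Shifted monomials of positive degree are killed by \<open>aug\<close>, so the
  coefficient of the empty monomial in \<open>r\<close> is \<open>aug r\<close>, which is
  zero.\<close>

lemma aug_kernel:
  assumes r: "r \<in> carrier (UP R)" "aug r = 0"
  shows "r \<in> Z.qspan (\<lambda>n. n \<ge> 1)"
proof -
  have "UK.lspan (range Z.qmon) = carrier (UP R)"
    by (rule UK.translate_full[OF Y shifted Yfull shift_qspan])
  moreover have "range Z.qmon \<subseteq> insert \<one>\<^bsub>UP R\<^esub> (Z.qmon ` {x. tdeg x \<ge> 1})"
  proof
    fix s assume "s \<in> range Z.qmon"
    then obtain x where x: "s = Z.qmon x" by blast
    show "s \<in> insert \<one>\<^bsub>UP R\<^esub> (Z.qmon ` {x. tdeg x \<ge> 1})"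
    proof (cases "tdeg x \<ge> 1")
      case False
      then have "x = ((0, 0, 0), 0)" by (cases x rule: tdeg.cases) simp
      then show ?thesis using x Z.qmon_0 by blast
    qed (use x in blast)
  qed
  ultimately have "r \<in> UK.lspan (insert \<one>\<^bsub>UP R\<^esub> (Z.qmon ` {x. tdeg x \<ge> 1}))"
    using r(1) UK.lspan_mono by blast
  then obtain c s where s: "s \<in> Z.qspan (\<lambda>n. n \<ge> 1)" "r = UK.smul c \<one>\<^bsub>UP R\<^esub> \<oplus>\<^bsub>UP R\<^esub> s"
    by (rule UK.lspan_insertD) simp
  have gr: "Z.qmon x \<in> {r \<in> carrier (UP R). tdeg x \<ge> 1 \<longrightarrow> aug r = 0}" for x
  proof (rule Z.qmon_graded_mem[where S = "\<lambda>n. {r \<in> carrier (UP R). n \<ge> 1 \<longrightarrow> aug r = 0}"])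
    show "{shift y1, shift y2, shift y3, shift t} \<subseteq> {r \<in> carrier (UP R). 1 \<le> (1::nat) \<longrightarrow> aug r = 0}"
      using Z.u_closed Z.t_closed by (simp add: shift_def aug_shift)
  qed (auto simp: aug_mult)
  have "aug s = 0" using s(1)
  proof (induction rule: UK.lspan.induct)
    case (lspan_step x s c)
    then have "aug s = 0" using gr by auto
    then show ?case using lspan_step by (simp add: aug_add aug_smul UK.lspan_carrier)
  qed simp
  then have "c = 0" using r(2) s UK.lspan_carrier by (simp add: aug_add aug_smul)
  then show ?thesis using s UK.lspan_carrier by simp
qed

text \<open>In \<open>hopf_indep\<close> the known basis consists of the monomials in the shifted
  generators, and the spanning system comes from \<open>z1\<close>, \<open>z2\<close>,
  \<open>z3\<close> and the variable. The latter lie in the kernel of \<open>aug\<close> because of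
  their positive degrees. The shift is essential: the original generators may have nonzero
  constants, and then the ideal spanned by their monomials of positive degree need not contain that
  kernel.\<close>

lemma homogeneous_gens_indep:
  assumes Yind: "UK.indep (qquad.qmon (UP R) y1 y2 y3 t)"
    and z: "qtriple R eta p z1 z2 z3"
    and w: "z1 \<in> G w1" "z2 \<in> G w2" "z3 \<in> G w3" "w1 \<ge> 1" "w2 \<ge> 1" "w3 \<ge> 1"
    and full: "lspan (range (qtriple.tmon R z1 z2 z3)) = carrier R"
  shows "indep (qtriple.tmon R z1 z2 z3)"
proof -
  interpret T: qtriple R eta p z1 z2 z3 by (rule z)
  have Zfull: "UK.lspan (range Z.qmon) = carrier (UP R)"
    by (rule UK.translate_full[OF Y shifted Yfull shift_qspan])
  have Zind: "UK.indep Z.qmon"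
    by (rule UK.translate_indep[OF Y shifted Yind Yfull shift_qspan])
  have aug0: "aug (mono_UP z 0) = 0" if "z \<in> G w" "w \<ge> 1" for z w
    using that hcomp_homog[OF that(1)] by (simp add: aug_def G_carrier eps_eq_0_iff)
  have gens: "{mono_UP z1 0, mono_UP z2 0, mono_UP z3 0, mono_UP \<one> 1} \<subseteq> Z.qspan (\<lambda>n. n \<ge> 1)"
  proof
    fix x assume "x \<in> {mono_UP z1 0, mono_UP z2 0, mono_UP z3 0, mono_UP \<one> 1}"
    moreover have "aug (mono_UP \<one> 1) = 0" by (simp add: aug_def)
    ultimately have "x \<in> carrier (UP R) \<and> aug x = 0"
      using w aug0 by (elim insertE) auto
    then show "x \<in> Z.qspan (\<lambda>n. n \<ge> 1)" using aug_kernel by blast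
  qed
  show ?thesis
    using UK.hopf_indep[OF shifted T.qquad_UP Zind Zfull T.UQ_full[OF full] gens] T.UQ_indep_iff by simp
qed

end

end

section \<open>Transport along the isomorphism\<close>

context qquad
begin

text \<open>Two monomials commute up to a nonzero scalar, so moving \<open>qmon e\<close> across
  \<open>r\<close> rescales each monomial of \<open>r\<close>.\<close>

lemma qmon_normal:
  assumes p: "p 1 2 \<noteq> 0" "p 1 3 \<noteq> 0" "p 2 3 \<noteq> 0"
    and full: "lspan (range qmon) = carrier R" and r: "r \<in> carrier R"
  shows "\<exists>r'\<in>carrier R. qmon e \<otimes> r = r' \<otimes> qmon e"
proof -
  have tw: "skew_tw p a b \<noteq> 0" for a b
    using p by (cases a; cases b) (simp add: skew_tw_simp)
  from r have "r \<in> lspan (range qmon)" using full by simp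
  then show ?thesis
  proof (induction rule: lspan.induct)
    case lspan_zero
    show ?case by (rule bexI[of _ \<zero>]) auto
  next
    case (lspan_step x s c)
    obtain x' where x': "x' \<in> carrier R" "qmon e \<otimes> x = x' \<otimes> qmon e" using lspan_step(4) by blast
    obtain i where i: "s = qmon i" using lspan_step by blast
    \<comment> \<open>The quotient of the two twists is the factor that \<open>qmon i\<close> picks
      up when \<open>qmon e\<close> crosses it.\<close>
    let ?q = "c * (skew_tw p (fst e) (fst i) / skew_tw p (fst i) (fst e))"
    have "?q \<star> (s \<otimes> qmon e) = qmon e \<otimes> (c \<star> s)"
      using tw unfolding i by (simp add: qmon_mult add.commute del: qmon.simps)
    then have "qmon e \<otimes> (c \<star> s \<oplus> x) = (?q \<star> s \<oplus> x') \<otimes> qmon e"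
      using x' lspan_step by (simp add: r_distr l_distr lspan_carrier del: qmon.simps)
    then show ?case using x' lspan_step by (intro bexI[of _ "?q \<star> s \<oplus> x'"]) auto
  qed
qed

end

lemma (in kalg) indep_nonzero: 
  assumes "indep e" "range e \<subseteq> carrier R"
  shows "e i \<noteq> \<zero>"
proof
  assume "e i = \<zero>"
  then have "lcomb e (\<lambda>x. if x = i then 1 else 0) = \<zero>"
    using lcomb_single[OF assms(2), of i 1] by simp
  moreover have "finite {x. (if x = i then 1 else 0 :: 'k) \<noteq> 0}" by simp
  ultimately have "(if i = i then 1 else 0 :: 'k) = 0" using indepD[OF assms(1), of "\<lambda>x. if x = i then 1 else 0"] by blast
  then show False by simp
qed

lemma (in UP_ring) nc_domain_coeff_ring: "nc_domain P \<Longrightarrow> nc_domain R"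
  unfolding nc_domain_def
proof (intro conjI ballI impI; elim conjE)
  assume "\<one>\<^bsub>P\<^esub> \<noteq> \<zero>\<^bsub>P\<^esub>"
  then show "\<one> \<noteq> \<zero>" using monom_one monom_zero by metis
  fix x y assume x: "x \<in> carrier R" "y \<in> carrier R" "x \<otimes> y = \<zero>"
    and n: "\<forall>x\<in>carrier P. \<forall>y\<in>carrier P. x \<otimes>\<^bsub>P\<^esub> y = \<zero>\<^bsub>P\<^esub> \<longrightarrow> x = \<zero>\<^bsub>P\<^esub> \<or> y = \<zero>\<^bsub>P\<^esub>"
  have "up_ring.monom P x 0 \<otimes>\<^bsub>P\<^esub> up_ring.monom P y 0 = \<zero>\<^bsub>P\<^esub>"
    using monom_mult[OF x(1,2), of 0 0] x(3) by simp
  then have "up_ring.monom P x 0 = \<zero>\<^bsub>P\<^esub> \<or> up_ring.monom P y 0 = \<zero>\<^bsub>P\<^esub>"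
    using n x by simp
  then show "x = \<zero> \<or> y = \<zero>"
    using coeff_monom[OF x(1), of 0 0] coeff_monom[OF x(2), of 0 0] by auto
qed

section \<open>Transport of bases and relations\<close>

locale kalg_iso = R?: kalg R etaR + S?: kalg S etaS
  for R (structure) and etaR :: "'k::field \<Rightarrow> 'a" and S (structure) and etaS :: "'k \<Rightarrow> 'b" +
  fixes h
  assumes iso: "alg_iso R etaR S etaS h"
begin

lemma h_hom: "ring_hom_ring R S h"
  using iso by (intro ring_hom_ringI2) (auto simp: alg_iso_def ring_iso_def R.ring_axioms S.ring_axioms)

sublocale H: ring_hom_ring R S h
  by (rule h_hom)

lemma h_bij: "bij_betw h (carrier R) (carrier S)"
  using iso by (simp add: alg_iso_def ring_iso_def)

lemma h_eta: "h (etaR c) = etaS c"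
  using iso by (simp add: alg_iso_def)

lemma h_zero_iff: "x \<in> carrier R \<Longrightarrow> h x = \<zero>\<^bsub>S\<^esub> \<longleftrightarrow> x = \<zero>\<^bsub>R\<^esub>"
  using h_bij H.hom_zero R.zero_closed unfolding bij_betw_def inj_on_def by metis

lemma h_smul: "x \<in> carrier R \<Longrightarrow> h (R.smul c x) = S.smul c (h x)"
  by (simp add: R.smul_def S.smul_def h_eta)

lemma h_lcomb: "range e \<subseteq> carrier R \<Longrightarrow> h (R.lcomb e d) = S.lcomb (h \<circ> e) d"
proof -
  assume e: "range e \<subseteq> carrier R"
  then have eR: "e x \<in> carrier R" for x by blast
  have "h (R.lcomb e d) = (\<Oplus>\<^bsub>S\<^esub>x\<in>{x. d x \<noteq> 0}. h (R.smul (d x) (e x)))"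
    unfolding R.lcomb_def using H.hom_finsum[of "\<lambda>x. R.smul (d x) (e x)"] eR by (simp add: comp_def Pi_def)
  also have "\<dots> = S.lcomb (h \<circ> e) d"
    unfolding S.lcomb_def using eR by (intro S.finsum_cong') (auto simp: h_smul)
  finally show ?thesis .
qed

lemma h_indep: "range e \<subseteq> carrier R \<Longrightarrow> R.indep e \<Longrightarrow> S.indep (h \<circ> e)"
  unfolding R.indep_def S.indep_def using h_lcomb h_zero_iff R.lcomb_closed by metis

lemma h_lspan: "x \<in> R.lspan U \<Longrightarrow> h x \<in> S.lspan (h ` U)"
  by (induction rule: R.lspan.induct) (simp_all add: h_smul R.lspan_carrier S.lspan.lspan_step)

lemma h_full: "R.lspan (range e) = carrier R \<Longrightarrow> S.lspan (range (h \<circ> e)) = carrier S"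
proof
  assume full: "R.lspan (range e) = carrier R"
  show "carrier S \<subseteq> S.lspan (range (h \<circ> e))"
  proof
    fix y assume "y \<in> carrier S"
    then obtain x where "x \<in> carrier R" "y = h x" using h_bij unfolding bij_betw_def by blast
    then show "y \<in> S.lspan (range (h \<circ> e))"
      using h_lspan[of x "range e"] full by (simp add: image_comp)
  qed
qed (use S.lspan_carrier in blast)

lemma h_nc_domain: "nc_domain R \<Longrightarrow> nc_domain S"
  unfolding nc_domain_def
proof (intro conjI ballI impI; elim conjE)
  assume "\<one>\<^bsub>R\<^esub> \<noteq> \<zero>\<^bsub>R\<^esub>"
  then show "\<one>\<^bsub>S\<^esub> \<noteq> \<zero>\<^bsub>S\<^esub>" using h_zero_iff[OF R.one_closed] H.hom_one by metis
  fix x y assume xy: "x \<in> carrier S" "y \<in> carrier S" "x \<otimes>\<^bsub>S\<^esub> y = \<zero>\<^bsub>S\<^esub>"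
    and n: "\<forall>x\<in>carrier R. \<forall>y\<in>carrier R. x \<otimes>\<^bsub>R\<^esub> y = \<zero>\<^bsub>R\<^esub> \<longrightarrow> x = \<zero>\<^bsub>R\<^esub> \<or> y = \<zero>\<^bsub>R\<^esub>"
  obtain a b where "a \<in> carrier R" "x = h a" "b \<in> carrier R" "y = h b"
    using xy h_bij unfolding bij_betw_def by blast
  then show "x = \<zero>\<^bsub>S\<^esub> \<or> y = \<zero>\<^bsub>S\<^esub>"
    using n xy(3) h_zero_iff by (metis H.hom_mult R.m_closed)
qed

lemma h_qquad:
  assumes "qquad R etaR p u1 u2 u3 t"
  shows "qquad S etaS p (h u1) (h u2) (h u3) (h t)"
proof -
  interpret Q: qquad R etaR p u1 u2 u3 t by (rule assms)
  have c: "h t \<otimes>\<^bsub>S\<^esub> x = x \<otimes>\<^bsub>S\<^esub> h t" if x: "x \<in> carrier S" for x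
  proof -
    obtain a where a: "a \<in> carrier R" "x = h a" using x h_bij unfolding bij_betw_def by blast
    have "h (t \<otimes>\<^bsub>R\<^esub> a) = h (a \<otimes>\<^bsub>R\<^esub> t)" using Q.t_central[OF a(1)] by (rule arg_cong)
    then show ?thesis unfolding a(2) H.hom_mult[OF Q.t_closed a(1)] H.hom_mult[OF a(1) Q.t_closed] .
  qed
  have r: "h u2 \<otimes>\<^bsub>S\<^esub> h u1 = S.smul (p 1 2) (h u1 \<otimes>\<^bsub>S\<^esub> h u2)"
    "h u3 \<otimes>\<^bsub>S\<^esub> h u1 = S.smul (p 1 3) (h u1 \<otimes>\<^bsub>S\<^esub> h u3)"
    "h u3 \<otimes>\<^bsub>S\<^esub> h u2 = S.smul (p 2 3) (h u2 \<otimes>\<^bsub>S\<^esub> h u3)"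
    using arg_cong[OF Q.u21, of h] arg_cong[OF Q.u31, of h] arg_cong[OF Q.u32, of h]
    by (simp_all add: h_smul)
  show ?thesis
    by (intro qquad.intro qtriple.intro qquad_axioms.intro qtriple_axioms.intro S.kalg_axioms r c)
      simp_all
qed

lemma h_qmon:
  assumes "qquad R etaR p u1 u2 u3 t"
  shows "qquad.qmon S (h u1) (h u2) (h u3) (h t) = h \<circ> qquad.qmon R u1 u2 u3 t"
proof
  interpret Q: qquad R etaR p u1 u2 u3 t by (rule assms)
  interpret Q': qquad S etaS p "h u1" "h u2" "h u3" "h t" by (rule h_qquad[OF assms])
  have pow: "h (x [^]\<^bsub>R\<^esub> n) = h x [^]\<^bsub>S\<^esub> n" if "x \<in> carrier R" for x and n :: nat
    using that by (induction n) simp_all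
  fix x :: "(nat \<times> nat \<times> nat) \<times> nat"
  obtain a b c n where "x = ((a, b, c), n)" by (metis prod.exhaust)
  then show "Q'.qmon x = (h \<circ> Q.qmon) x" by (simp add: pow)
qed

end

context qtriple
begin

text \<open>The hypotheses make \<open>tmon\<close> a PBW basis of \<open>R\<close>. It has the
  structure constants \<open>skew_tw p\<close>, as do the monomials of the model, so the linear
  bijection between them is multiplicative; \<open>coord tmon\<close> inverts it.\<close>

lemma skew_poly_iso:
  assumes ind: "indep tmon" and full: "lspan (range tmon) = carrier R"
  shows "alg_iso (skew_poly p) (skew_unit p) R eta (lcomb tmon)"
proof -
  let ?A = "skew_poly p" and ?f = "lcomb tmon"
  have tmR: "range tmon \<subseteq> carrier R" by auto
  have fin: "finite {m. x m \<noteq> 0}" if "x \<in> carrier ?A" for x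
    using that by (simp add: skew_poly_sel)
  have f_closed: "?f x \<in> carrier R" for x by (rule lcomb_closed[OF tmR])
  have f_add: "?f (x \<oplus>\<^bsub>?A\<^esub> y) = ?f x \<oplus> ?f y" if "x \<in> carrier ?A" "y \<in> carrier ?A" for x y
    unfolding skew_poly_sel by (rule lcomb_add[OF tmR fin fin]) (use that in auto)
  have f_smul: "?f (A.smul p c x) = c \<star> ?f x" if "x \<in> carrier ?A" for c x
    unfolding A_smul by (rule lcomb_smul[OF tmR fin[OF that]])
  have f_tmon: "?f (AQ.tmon p m) = tmon m" for m
    unfolding AQ_tmon using lcomb_single[OF tmR, of m 1] by (simp add: single_def)
  have f_zero: "?f \<zero>\<^bsub>?A\<^esub> = \<zero>" by (simp add: skew_poly_sel lcomb_zero)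
  have A_span: "x \<in> A.lspan p (range (AQ.tmon p))" if "x \<in> carrier ?A" for x
    using A.lcomb_in_lspan[of "AQ.tmon p" p x UNIV] A_lcomb[OF fin[OF that], of p] fin[OF that]
    by (simp add: image_subset_iff)
  have mult_tmon: "?f (AQ.tmon p m \<otimes>\<^bsub>?A\<^esub> y) = tmon m \<otimes> ?f y" if y: "y \<in> carrier ?A" for m y
    using A_span[OF y]
  proof (induction rule: A.lspan.induct)
    case lspan_zero
    then show ?case by (simp add: f_zero del: AQ.tmon.simps)
  next
    case (lspan_step y s c)
    obtain n where s: "s = AQ.tmon p n" using lspan_step by blast
    have [simp]: "y \<in> carrier ?A" using lspan_step A.lspan_carrier by blast
    show ?case using lspan_step(4) f_closed unfolding s
      by (simp add: A.r_distr f_add f_smul f_tmon AQ.tmon_mult tmon_mult r_distr mult.commute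
          del: AQ.tmon.simps tmon.simps)
  qed
  have f_mult: "?f (x \<otimes>\<^bsub>?A\<^esub> y) = ?f x \<otimes> ?f y" if x: "x \<in> carrier ?A" and y: "y \<in> carrier ?A" for x y
    using A_span[OF x]
  proof (induction rule: A.lspan.induct)
    case lspan_zero
    then show ?case using y f_closed by (simp add: f_zero)
  next
    case (lspan_step x s c)
    obtain n where s: "s = AQ.tmon p n" using lspan_step by blast
    have [simp]: "x \<in> carrier ?A" using lspan_step A.lspan_carrier by blast
    show ?case using lspan_step(4) f_closed y unfolding s
      by (simp add: A.l_distr f_add f_smul f_tmon mult_tmon l_distr del: AQ.tmon.simps tmon.simps)
  qed
  have f_eta: "?f (skew_unit p c) = eta c" for c
    unfolding skew_unit_def using lcomb_single[OF tmR, of "(0, 0, 0)" c] by (simp add: smul_one)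
  have "?f \<in> ring_hom ?A R"
  proof (rule ring_hom_memI)
    show "?f \<one>\<^bsub>?A\<^esub> = \<one>" using f_eta[of 1] by (simp add: skew_unit_single skew_poly_sel)
  qed (use f_closed f_mult f_add in auto)
  moreover have "bij_betw ?f (carrier ?A) (carrier R)"
    unfolding bij_betw_def
  proof
    show "inj_on ?f (carrier ?A)"
      by (rule inj_on_inverseI[of _ "coord tmon"]) (simp add: coord_unique[OF tmR ind fin])
    show "?f ` carrier ?A = carrier R"
    proof
      show "carrier R \<subseteq> ?f ` carrier ?A"
      proof
        fix r assume "r \<in> carrier R"
        then have "r \<in> lspan (tmon ` UNIV)" using full by simp
        then obtain d where "finite {x. d x \<noteq> 0}" "r = ?f d" by (rule lspan_lcomb[OF _ tmR])
        then show "r \<in> ?f ` carrier ?A" by (auto simp: skew_poly_sel)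
      qed
    qed (use f_closed in auto)
  qed
  ultimately show ?thesis using f_eta by (simp add: alg_iso_def ring_iso_def)
qed

end

lemma AQ_full: "A.lspan p (range (AQ.tmon p)) = carrier (skew_poly p)"
proof
  show "carrier (skew_poly p) \<subseteq> A.lspan p (range (AQ.tmon p))"
  proof
    fix x assume "x \<in> carrier (skew_poly p)"
    then have "finite {m. x m \<noteq> 0}" by (simp add: skew_poly_sel)
    then show "x \<in> A.lspan p (range (AQ.tmon p))"
      using A.lcomb_in_lspan[of "AQ.tmon p" p x UNIV] A_lcomb[of x p] by (simp add: image_subset_iff)
  qed
qed (use A.lspan_carrier in blast)

lemma AQ_indep: "A.indep p (AQ.tmon p)"
  unfolding A.indep_def using A_lcomb by (metis skew_poly_sel(4))

theorem theorem4p14: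
  fixes p :: "nat \<Rightarrow> nat \<Rightarrow> 'k::field_char_0"
    and B :: "'b ring" and etaB :: "'k \<Rightarrow> 'b" and G :: "nat \<Rightarrow> 'b set"
  assumes "\<forall>i\<in>{1,2,3}. p i i = 1"
    and "\<forall>i\<in>{1,2,3}. \<forall>j\<in>{1,2,3}. p i j * p j i = 1"
    and PI: "\<forall>i\<in>{1,2,3}. \<forall>j\<in>{1,2,3}. \<exists>n>0. p i j ^ n = 1"
    and "k_algebra B etaB"
    and "conn_graded B etaB G"
    and "\<exists>phi. alg_iso (UP (skew_poly p)) (poly_unit (skew_poly p) (skew_unit p))
                      (UP B) (poly_unit B etaB) phi"
  shows "\<exists>psi. alg_iso (skew_poly p) (skew_unit p) B etaB psi"
proof -
  \<comment> \<open>Nonzero parameters give nonzero twists, on which both the domain property and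
    the normality of monomials rest.\<close>
  have "p 1 2 * p 2 1 = 1" "p 1 3 * p 3 1 = 1" "p 2 3 * p 3 2 = 1" using assms(2) by auto
  then have p: "p 1 2 \<noteq> 0" "p 1 3 \<noteq> 0" "p 2 3 \<noteq> 0" by auto
  obtain phi where phi: "alg_iso (UP (skew_poly p)) (poly_unit (skew_poly p) (skew_unit p))
    (UP B) (poly_unit B etaB) phi" using assms by blast
  interpret B: kalg B etaB using assms(4) by (simp add: kalg_iff)
  interpret UA: kalg "UP (skew_poly p)" "poly_unit (skew_poly p) (skew_unit p)" by (rule A.kalg_UP)
  interpret UB: kalg "UP B" "poly_unit B etaB" by (rule B.kalg_UP)
  interpret I: kalg_iso "UP (skew_poly p)" "poly_unit (skew_poly p) (skew_unit p)" "UP B" "poly_unit B etaB" phi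
    by unfold_locales (rule phi)
  \<comment> \<open>The property passes from \<open>A\<close> to \<open>A[t]\<close>, along
    \<open>phi\<close> to \<open>B[t]\<close>, and down to \<open>B\<close>, which embeds as the
    constants.\<close>
  have "nc_domain (UP B)" by (rule I.h_nc_domain[OF A.U.nc_domain_UP[OF nc_domain_skew_poly[OF p]]])
  then interpret B: graded_kalg B etaB G
    using B.U.nc_domain_coeff_ring assms(5) by unfold_locales auto
  define y1 y2 y3 t where "y1 = phi (up_ring.monom (UP (skew_poly p)) sx1 0)"
    and "y2 = phi (up_ring.monom (UP (skew_poly p)) sx2 0)"
    and "y3 = phi (up_ring.monom (UP (skew_poly p)) sx3 0)"
    and "t = phi (up_ring.monom (UP (skew_poly p)) \<one>\<^bsub>skew_poly p\<^esub> 1)"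
  note y_defs = y1_def[symmetric] y2_def[symmetric] y3_def[symmetric] t_def[symmetric]
  have qA: "qquad (UP (skew_poly p)) (poly_unit (skew_poly p) (skew_unit p)) p 
    (up_ring.monom (UP (skew_poly p)) sx1 0) (up_ring.monom (UP (skew_poly p)) sx2 0)
    (up_ring.monom (UP (skew_poly p)) sx3 0) (up_ring.monom (UP (skew_poly p)) \<one>\<^bsub>skew_poly p\<^esub> 1)"
    by (rule AQ.qquad_UP)
  interpret QA: qquad "UP (skew_poly p)" "poly_unit (skew_poly p) (skew_unit p)" p 
    "up_ring.monom (UP (skew_poly p)) sx1 0" "up_ring.monom (UP (skew_poly p)) sx2 0"
    "up_ring.monom (UP (skew_poly p)) sx3 0" "up_ring.monom (UP (skew_poly p)) \<one>\<^bsub>skew_poly p\<^esub> 1"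
    by (rule qA)
  have Y: "qquad (UP B) (poly_unit B etaB) p y1 y2 y3 t"
    using I.h_qquad[OF qA] unfolding y_defs .
  interpret Y: qquad "UP B" "poly_unit B etaB" p y1 y2 y3 t by (rule Y)
  have qmon: "Y.qmon = phi \<circ> QA.qmon"
    using I.h_qmon[OF qA] unfolding y_defs .
  have Yfull: "UB.lspan (range Y.qmon) = carrier (UP B)"
    unfolding qmon by (rule I.h_full[OF AQ.UQ_full[OF AQ_full]])
  have Yind: "UB.indep Y.qmon"
    unfolding qmon by (rule I.h_indep[OF QA.qmon_range]) (use AQ.UQ_indep_iff AQ_indep in blast)
  have nz: "y1 \<noteq> \<zero>\<^bsub>UP B\<^esub>" "y2 \<noteq> \<zero>\<^bsub>UP B\<^esub>" "y3 \<noteq> \<zero>\<^bsub>UP B\<^esub>" "t \<noteq> \<zero>\<^bsub>UP B\<^esub>"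
    using UB.indep_nonzero[OF Yind Y.qmon_range] Y.qmon_gen by metis+
  \<comment> \<open>Both elements are monomials with a single exponent 1, so
    \<open>qmon_normal\<close> covers them.\<close>
  have normal: "\<exists>r'\<in>carrier (UP B). y \<otimes>\<^bsub>UP B\<^esub> r = r' \<otimes>\<^bsub>UP B\<^esub> y"
    if "y \<in> {y2, y3}" "r \<in> carrier (UP B)" for y r
    using Y.qmon_normal[OF p Yfull that(2)] Y.qmon_gen that(1) by (metis insertE singletonD)
  have "B.homogeneous_gens p" by (rule B.homogeneous_gens[OF Y Yfull nz normal])
  then obtain z1 z2 z3 w1 w2 w3 where w: "z1 \<in> G w1" "z2 \<in> G w2" "z3 \<in> G w3" "w1 \<ge> 1" "w2 \<ge> 1" "w3 \<ge> 1"
    and z: "qtriple B etaB p z1 z2 z3"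
    and gen: "carrier B = B.lspan (insert z1 (insert z2 (insert z3 B.decomposable)))"
    unfolding B.homogeneous_gens_def by blast
  have full: "B.lspan (range (qtriple.tmon B z1 z2 z3)) = carrier B"
    by (rule B.homogeneous_gens_full[OF z w(1-3) gen])
  have "B.indep (qtriple.tmon B z1 z2 z3)"
    by (rule B.homogeneous_gens_indep[OF Y Yfull nz normal Yind z w full])
  then show ?thesis using qtriple.skew_poly_iso[OF z _ full] by blast
qed

end
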